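(* Let $M_n$ be an $n\times n$ random matrix whose $n^2$ entries are independent random variables, each taking the values $+1$ and $-1$ with probability $1/2$. Then $$\mathbf{P}\Big(|\det M_n| \ge \sqrt{n!}\,\exp\big(-29\, n^{1/2}(\ln n)^{1/2}\big)\Big) = 1-o(1),$$ where $o(1)$ denotes a quantity tending to $0$ as $n\to\infty$. *)

theory Defs
  imports "HOL-Probability.Probability" "Jordan_Normal_Form.Determinant"
begin

definition random_sign_entries :: "nat \<Rightarrow> 'w measure \<Rightarrow> (nat \<Rightarrow> nat \<Rightarrow> 'w \<Rightarrow> real) \<Rightarrow> bool" where
  "random_sign_entries n P X \<longleftrightarrow>
     prob_space P \<and>
     prob_space.indep_vars P (\<lambda>_. borel) (\<lambda>(i, j). X i j) ({..<n} \<times> {..<n}) \<and>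
     (\<forall>i<n. \<forall>j<n.
        measure P {\<omega> \<in> space P. X i j \<omega> = 1} = 1 / 2 \<and>
        measure P {\<omega> \<in> space P. X i j \<omega> = -1} = 1 / 2)"

definition random_matrix :: "nat \<Rightarrow> (nat \<Rightarrow> nat \<Rightarrow> 'w \<Rightarrow> real) \<Rightarrow> 'w \<Rightarrow> real Matrix.mat" where
  "random_matrix n X \<omega> = Matrix.mat n n (\<lambda>(i, j). X i j \<omega>)"

end

theory Submission
  imports Defs "HOL-Real_Asymp.Real_Asymp"
begin

text \<open>
  The squared determinant is the product of the squared distances \<open>r\<^sub>d\<close> from row \<open>d\<close> to the span of the
  rows before it. Conditionally on the other rows, \<open>r\<^sub>d\<close> is a quadratic form in a random sign vector
  with mean \<open>k = n - d\<close> and variance at most \<open>2k\<close>. As long as no \<open>r\<^sub>d\<close> is smaller than a fixed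
  negative power of \<open>n\<close>, we have
  \<open>- ln (r\<^sub>d / k) \<le> 1 / sqrt k + (r\<^sub>d / k - 1)\<^sup>2 (sqrt k + O (ln n))\<close>, whose sum over \<open>d\<close> has expectation
  \<open>O (sqrt n)\<close>, and Markov's inequality concludes.

  That no \<open>r\<^sub>d\<close> is tiny is shown in two regimes. If \<open>k \<ge> K\<close>, a quantitative form of Odlyzko's lemma
  bounds the probability by about \<open>2\<close> to the power \<open>-k\<close>, which is summable. If \<open>k < K\<close>, with high
  probability every sign pattern on every \<open>m\<close>-set of columns occurs among the first \<open>n - K\<close> rows; a unit
  normal to these rows then has at least \<open>m\<close> coordinates of size \<open>1 / (2n)\<close>, and the Littlewood--Offord
  inequality bounds the probability by \<open>O (1 / sqrt m)\<close>. Let first \<open>n\<close>, then \<open>m\<close>, then \<open>K\<close> tend to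
  infinity.
\<close>

section \<open>Littlewood--Offord via the LYM inequality\<close>

text \<open>Counting form of conditioning: all coordinates but \<open>d\<close> are fixed first. It
  is used for one coordinate of a sign vector and for one row of a sign matrix.\<close>

lemma sum_PiE_split:
  assumes "d \<in> I"
  shows "(\<Sum>f\<in>Pi\<^sub>E I (\<lambda>_. B). g f) = (\<Sum>f\<in>Pi\<^sub>E (I - {d}) (\<lambda>_. B). \<Sum>x\<in>B. g (f(d := x)))"
proof -
  have I: "I = insert d (I - {d})" using assms by auto
  have "(\<Sum>f\<in>Pi\<^sub>E I (\<lambda>_. B). g f) = (\<Sum>p\<in>B \<times> Pi\<^sub>E (I - {d}) (\<lambda>_. B). g ((\<lambda>(y, f). f(d := y)) p))"
    by (subst I, subst PiE_insert_eq, rule sum.reindex[unfolded o_def], rule inj_combinator) simp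
  also have "\<dots> = (\<Sum>y\<in>B. \<Sum>f\<in>Pi\<^sub>E (I - {d}) (\<lambda>_. B). g (f(d := y)))"
    by (subst sum.cartesian_product) (auto intro!: sum.cong)
  also have "\<dots> = (\<Sum>f\<in>Pi\<^sub>E (I - {d}) (\<lambda>_. B). \<Sum>x\<in>B. g (f(d := x)))"
    by (rule sum.swap)
  finally show ?thesis .
qed

definition signs :: "'a set \<Rightarrow> ('a \<Rightarrow> real) set" where
  "signs I = Pi\<^sub>E I (\<lambda>_. {-1, 1})"

lemma finite_signs [simp]: "finite I \<Longrightarrow> finite (signs I)"
  by (simp add: signs_def finite_PiE)

lemma card_signs: "finite I \<Longrightarrow> card (signs I) = 2 ^ card I"
  by (simp add: signs_def card_PiE numeral_2_eq_2)

lemma signs_cases: "x \<in> signs I \<Longrightarrow> i \<in> I \<Longrightarrow> x i = 1 \<or> x i = -1"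
  unfolding signs_def by (drule PiE_mem) auto

lemma sum_signs_insert:
  assumes "i \<notin> I"
  shows "(\<Sum>x\<in>signs (insert i I). g x) = (\<Sum>x\<in>signs I. g (x(i := 1)) + g (x(i := -1)))"
proof -
  have "insert i I - {i} = I" using assms by auto
  then show ?thesis
    using sum_PiE_split[of i "insert i I" g "{-1, 1}"]
    by (simp add: signs_def add.commute)
qed

text \<open>Induction on the size of the ground set. An antichain that contains \<open>A\<close> is
  just \<open>{A}\<close>; otherwise average over \<open>x\<close> in \<open>A\<close> the
  inequality for the members avoiding \<open>x\<close>, which live on \<open>A - {x}\<close>. A
  member \<open>X\<close> is counted \<open>card A - card X\<close> times, and the absorption
  identity for binomials turns this multiplicity into the correct weight.\<close>

lemma LYM_inequality:
  assumes "finite A" "F \<subseteq> Pow A" "\<And>X Y. X \<in> F \<Longrightarrow> Y \<in> F \<Longrightarrow> X \<subseteq> Y \<Longrightarrow> X = Y"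
  shows "(\<Sum>X\<in>F. 1 / real (card A choose card X)) \<le> 1"
  using assms
proof (induction "card A" arbitrary: A F)
  case 0
  then have "A = {}" by simp
  then have "F = {} \<or> F = {{}}" using 0(3) by auto
  then show ?case by auto
next
  case (Suc m)
  have finF: "finite F" using Suc.prems by (meson finite_Pow_iff finite_subset)
  show ?case
  proof (cases "A \<in> F")
    case True
    then have "F = {A}" using Suc.prems by blast
    then show ?thesis by simp
  next
    case False
    define Fx where "Fx x = {X \<in> F. x \<notin> X}" for x
    have IH: "(\<Sum>X\<in>Fx x. 1 / real (m choose card X)) \<le> 1" if "x \<in> A" for x
    proof -
      have "m = card (A - {x})" using Suc.hyps(2) Suc.prems(1) that by simp
      moreover have "Fx x \<subseteq> Pow (A - {x})" using Suc.prems(2) by (auto simp: Fx_def)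
      ultimately show ?thesis using Suc.hyps(1)[of "A - {x}" "Fx x"] Suc.prems
        by (auto simp: Fx_def)
    qed
    have eq: "1 / real (card A choose card X) = (\<Sum>x\<in>A - X. 1 / (real (Suc m) * real (m choose card X)))"
      if "X \<in> F" for X
    proof -
      have sub: "X \<subseteq> A" "X \<noteq> A" using that False Suc.prems(2) by auto
      have lt: "card X < card A" using sub Suc.prems(1) by (simp add: psubset_card_mono psubsetI)
      have cd: "card (A - X) = Suc m - card X" using sub Suc.prems(1) Suc.hyps(2)
        by (simp add: card_Diff_subset finite_subset)
      have "(Suc m - card X) * (Suc m choose card X) = Suc m * (m choose card X)"
        using binomial_absorb_comp[of "Suc m" "card X"] by simp
      then have "real (Suc m - card X) * real (Suc m choose card X) = real (Suc m) * real (m choose card X)"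
        by (metis of_nat_mult)
      moreover have "real (Suc m choose card X) > 0" "real (m choose card X) > 0"
        using lt Suc.hyps(2) by (simp_all add: less_imp_le)
      ultimately have "1 / real (Suc m choose card X) = real (Suc m - card X) * (1 / (real (Suc m) * real (m choose card X)))"
        by (simp add: divide_simps del: of_nat_Suc)
      then show ?thesis using cd Suc.hyps(2) by simp
    qed
    have "(\<Sum>X\<in>F. 1 / real (card A choose card X))
        = (\<Sum>X\<in>F. \<Sum>x\<in>A - X. 1 / (real (Suc m) * real (m choose card X)))"
      using eq by (intro sum.cong) auto
    also have "\<dots> = (\<Sum>X\<in>F. \<Sum>x | x \<in> A \<and> x \<notin> X. 1 / (real (Suc m) * real (m choose card X)))"
      by (intro sum.cong) auto
    also have "\<dots> = (\<Sum>x\<in>A. \<Sum>X | X \<in> F \<and> x \<notin> X. 1 / (real (Suc m) * real (m choose card X)))"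
      using finF Suc.prems(1) by (rule sum.swap_restrict)
    also have "\<dots> = (\<Sum>x\<in>A. (1 / real (Suc m)) * (\<Sum>X\<in>Fx x. 1 / real (m choose card X)))"
      by (simp add: Fx_def sum_distrib_left)
    also have "\<dots> \<le> (\<Sum>x\<in>A. (1 / real (Suc m)) * 1)"
      using IH by (intro sum_mono mult_left_mono) auto
    also have "\<dots> = 1" by (simp flip: Suc.hyps(2))
    finally show ?thesis .
  qed
qed

text \<open>Erdos's argument: send \<open>x\<close> to the set of indices with a positive summand.
  Enlarging this set raises the sum by at least \<open>2 * \<tau>\<close>, the length of the open
  window, so the images of solutions form an antichain. The LYM inequality and the maximality of the
  central binomial coefficient bound its size.\<close>

lemma Littlewood_Offord:
  fixes u :: "'a \<Rightarrow> real"
  assumes "finite S" and u: "\<And>i. i \<in> S \<Longrightarrow> \<tau> \<le> \<bar>u i\<bar>" and "\<tau> > 0"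
  shows "card {x \<in> signs S. \<bar>(\<Sum>i\<in>S. x i * u i) + a\<bar> < \<tau>} \<le> card S choose (card S div 2)"
proof -
  define B where "B = {x \<in> signs S. \<bar>(\<Sum>i\<in>S. x i * u i) + a\<bar> < \<tau>}"
  define \<phi> where "\<phi> x = {i \<in> S. x i * u i > 0}" for x :: "'a \<Rightarrow> real"
  define s where "s X = (\<Sum>i\<in>S. if i \<in> X then \<bar>u i\<bar> else - \<bar>u i\<bar>)" for X
  have unz: "u i \<noteq> 0" if "i \<in> S" for i using u[OF that] assms(3) by auto
  have s: "s (\<phi> x) = (\<Sum>i\<in>S. x i * u i)" if "x \<in> signs S" for x
    unfolding s_def
  proof (intro sum.cong refl)
    fix i assume "i \<in> S"
    then show "(if i \<in> \<phi> x then \<bar>u i\<bar> else - \<bar>u i\<bar>) = x i * u i"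
      using signs_cases[OF that, of i] unz[of i] by (auto simp: \<phi>_def)
  qed
  have inj: "inj_on \<phi> B"
  proof (rule inj_onI)
    fix x y assume xy: "x \<in> B" "y \<in> B" "\<phi> x = \<phi> y"
    show "x = y"
    proof (rule PiE_ext[where k = S and s = "\<lambda>_. {-1, 1::real}"])
      show "x \<in> Pi\<^sub>E S (\<lambda>_. {-1, 1})" "y \<in> Pi\<^sub>E S (\<lambda>_. {-1, 1})" using xy by (auto simp: B_def signs_def)
      fix i assume i: "i \<in> S"
      have "x i = 1 \<or> x i = -1" "y i = 1 \<or> y i = -1"
        using xy i by (auto simp: B_def dest: signs_cases)
      moreover have "x i * u i > 0 \<longleftrightarrow> y i * u i > 0" using xy(3) i by (auto simp: \<phi>_def set_eq_iff)
      ultimately show "x i = y i" using unz[OF i] by auto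
    qed
  qed
  have anti: "X = Y" if XB: "X \<in> \<phi> ` B" and YB: "Y \<in> \<phi> ` B" and XY: "X \<subseteq> Y" for X Y
  proof (rule ccontr)
    assume "X \<noteq> Y"
    have YS: "Y \<subseteq> S" using YB by (auto simp: \<phi>_def)
    obtain j where j: "j \<in> Y" "j \<notin> X" using \<open>X \<noteq> Y\<close> XY by auto
    have "s Y - s X = (\<Sum>i\<in>S. if i \<in> Y \<and> i \<notin> X then 2 * \<bar>u i\<bar> else 0)"
      unfolding s_def sum_subtractf[symmetric] using XY by (intro sum.cong) auto
    also have "\<dots> \<ge> (\<Sum>i\<in>{j}. if i \<in> Y \<and> i \<notin> X then 2 * \<bar>u i\<bar> else 0)"
      using j YS assms(1) by (intro sum_mono2) auto
    finally have "s Y - s X \<ge> 2 * \<tau>" using j YS u[of j] by auto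
    moreover have "\<bar>s X + a\<bar> < \<tau>" "\<bar>s Y + a\<bar> < \<tau>" using XB YB s by (auto simp: B_def)
    ultimately show False by linarith
  qed
  have sub: "\<phi> ` B \<subseteq> Pow S" by (auto simp: \<phi>_def)
  let ?C = "real (card S choose (card S div 2))"
  have "real (card (\<phi> ` B)) / ?C = (\<Sum>X\<in>\<phi> ` B. 1 / ?C)" by simp
  also have "\<dots> \<le> (\<Sum>X\<in>\<phi> ` B. 1 / real (card S choose card X))"
  proof (rule sum_mono)
    fix X assume "X \<in> \<phi> ` B"
    then have "card X \<le> card S" using sub assms(1) by (auto intro: card_mono)
    then have "(card S choose card X) > 0" by simp
    then show "1 / ?C \<le> 1 / real (card S choose card X)"
      by (intro divide_left_mono) (auto simp: binomial_maximum)
  qed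
  also have "\<dots> \<le> 1" by (rule LYM_inequality[OF assms(1) sub anti])
  finally have "real (card (\<phi> ` B)) \<le> ?C" by (simp add: divide_le_eq)
  then show ?thesis using card_image[OF inj] by (simp add: B_def)
qed

lemma Littlewood_Offord_subset:
  fixes u :: "'a \<Rightarrow> real"
  assumes "finite S" "\<And>i. i \<in> S \<Longrightarrow> \<tau> \<le> \<bar>u i\<bar>" "\<tau> > 0" "finite I" "S \<subseteq> I"
  shows "(\<Sum>x\<in>signs I. of_bool (\<bar>\<Sum>i\<in>I. x i * u i\<bar> < \<tau>))
     \<le> real (card S choose (card S div 2)) / 2 ^ card S * 2 ^ card I"
proof -
  \<comment> \<open>The shift \<open>a\<close> must be arbitrary: fixing the sign of a coordinate
    outside \<open>S\<close> moves its contribution into the shift.\<close>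
  have main: "(\<Sum>x\<in>signs (S \<union> T). of_bool (\<bar>(\<Sum>i\<in>S \<union> T. x i * u i) + a\<bar> < \<tau>))
     \<le> real (card S choose (card S div 2)) * 2 ^ card T" if "finite T" "T \<inter> S = {}" for T a
    using that
  proof (induction T arbitrary: a rule: finite_induct)
    case empty
    have "(\<Sum>x\<in>signs S. of_bool (\<bar>(\<Sum>i\<in>S. x i * u i) + a\<bar> < \<tau>))
        = real (card {x \<in> signs S. \<bar>(\<Sum>i\<in>S. x i * u i) + a\<bar> < \<tau>})"
      using assms(1) by (simp add: of_bool_def sum.If_cases Int_def)
    then show ?case using Littlewood_Offord[OF assms(1-3), where a = a] by simp
  next
    case (insert j T)
    have j: "j \<notin> S \<union> T" and fin: "finite (S \<union> T)" using insert assms by auto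
    have eq: "(\<Sum>i\<in>insert j (S \<union> T). (x(j := c)) i * u i) + a = (\<Sum>i\<in>S \<union> T. x i * u i) + (c * u j + a)" for x :: "'a \<Rightarrow> real" and c :: real
    proof -
      have "(\<Sum>i\<in>S \<union> T. (x(j := c)) i * u i) = (\<Sum>i\<in>S \<union> T. x i * u i)"
        using j by (intro sum.cong) auto
      then show ?thesis using j fin by simp
    qed
    have "(\<Sum>x\<in>signs (S \<union> insert j T). of_bool (\<bar>(\<Sum>i\<in>S \<union> insert j T. x i * u i) + a\<bar> < \<tau>))
       = (\<Sum>x\<in>signs (S \<union> T). (of_bool (\<bar>(\<Sum>i\<in>S \<union> T. x i * u i) + (1 * u j + a)\<bar> < \<tau>) :: real)
           + of_bool (\<bar>(\<Sum>i\<in>S \<union> T. x i * u i) + (-1 * u j + a)\<bar> < \<tau>))"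
      unfolding Un_insert_right sum_signs_insert[OF j] eq ..
    also have "\<dots> \<le> real (card S choose (card S div 2)) * 2 ^ card T + real (card S choose (card S div 2)) * 2 ^ card T"
      unfolding sum.distrib using insert by (intro add_mono) auto
    finally show ?case using insert by (simp add: mult_ac)
  qed
  have "S \<union> (I - S) = I" using assms by auto
  moreover have "card I = card S + card (I - S)"
    using assms by (metis card_Diff_subset card_mono le_add_diff_inverse)
  moreover have "(I - S) \<inter> S = {}" by auto
  ultimately show ?thesis using main[of "I - S" 0] assms(4) by (simp add: power_add)
qed

text \<open>The squared form is inductive: consecutive central binomials have ratio
  \<open>2 * (2 * m + 1) / (m + 1)\<close>, and
  \<open>(2 * m + 1) * (2 * m + 3) \<le> 4 * (m + 1)^2\<close>.\<close>

lemma central_binomial_upper: "real ((2 * m) choose m) / 2 ^ (2 * m) \<le> 1 / sqrt (2 * real m + 1)"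
proof -
  have "(real ((2 * m) choose m))\<^sup>2 * (2 * real m + 1) \<le> (2 ^ (2 * m))\<^sup>2"
  proof (induction m)
    case 0
    then show ?case by simp
  next
    case (Suc m)
    have "Suc m * ((2 * Suc m) choose Suc m) = 2 * Suc m * ((2 * m + 1) choose m)"
      using Suc_times_binomial[of m "2 * m + 1"] by simp
    then have "Suc m * ((2 * Suc m) choose Suc m) = Suc m * (2 * ((2 * m + 1) choose m))" by (simp only: mult_ac)
    then have 1: "((2 * Suc m) choose Suc m) = 2 * ((2 * m + 1) choose m)" by (simp only: mult_cancel1) simp
    have "(m + 1) * ((2 * m + 1) choose m) = (2 * m + 1) * ((2 * m) choose m)"
      using binomial_absorb_comp[of "2 * m + 1" m] by simp
    then have "(real m + 1) * real ((2 * m + 1) choose m) = (2 * real m + 1) * real ((2 * m) choose m)"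
      by (metis (mono_tags, lifting) of_nat_1 of_nat_add of_nat_mult of_nat_numeral)
    then have 2: "(real m + 1) * real ((2 * Suc m) choose Suc m) = 2 * (2 * real m + 1) * real ((2 * m) choose m)"
      unfolding 1 by (simp only: of_nat_mult of_nat_numeral mult_ac)
    have "2 * real (Suc m) + 1 = 2 * real m + 3" by simp
    then have "(real m + 1)\<^sup>2 * ((real ((2 * Suc m) choose Suc m))\<^sup>2 * (2 * real (Suc m) + 1))
        = (2 * (2 * real m + 1) * real ((2 * m) choose m))\<^sup>2 * (2 * real m + 3)"
      unfolding 2[symmetric] by (simp only: power_mult_distrib mult_ac)
    also have "\<dots> = (4 * (2 * real m + 1) * (2 * real m + 3)) * ((real ((2 * m) choose m))\<^sup>2 * (2 * real m + 1))"
      by (simp add: power2_eq_square algebra_simps)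
    also have "\<dots> \<le> (16 * (real m + 1)\<^sup>2) * (2 ^ (2 * m))\<^sup>2"
    proof (rule mult_mono)
      show "4 * (2 * real m + 1) * (2 * real m + 3) \<le> 16 * (real m + 1)\<^sup>2"
        by (simp add: power2_eq_square algebra_simps)
    qed (use Suc.IH in auto)
    also have "\<dots> = (real m + 1)\<^sup>2 * (2 ^ (2 * Suc m))\<^sup>2"
      by (simp add: power2_eq_square)
    finally show ?case by (subst (asm) mult_le_cancel_left_pos) auto
  qed
  then have "(real ((2 * m) choose m) / 2 ^ (2 * m))\<^sup>2 \<le> 1 / (2 * real m + 1)"
    by (simp add: power_divide divide_simps mult.commute)
  then have "real ((2 * m) choose m) / 2 ^ (2 * m) \<le> sqrt (1 / (2 * real m + 1))"
    by (rule real_le_rsqrt)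
  then show ?thesis by (simp add: real_sqrt_divide)
qed

section \<open>Sign vectors: variance of quadratic forms and small-ball bounds\<close>

lemma sum_signs_linear_square:
  fixes c :: "'a \<Rightarrow> real"
  assumes "finite I"
  shows "(\<Sum>x\<in>signs I. (\<Sum>a\<in>I. c a * x a)\<^sup>2) = 2 ^ card I * (\<Sum>a\<in>I. (c a)\<^sup>2)"
  using assms
proof (induction I rule: finite_induct)
  case empty
  then show ?case by simp
next
  case (insert i I)
  have eq: "(\<Sum>a\<in>insert i I. c a * (x(i := t)) a) = c i * t + (\<Sum>a\<in>I. c a * x a)"
    for x :: "'a \<Rightarrow> real" and t :: real
  proof -
    have "(\<Sum>a\<in>I. c a * (x(i := t)) a) = (\<Sum>a\<in>I. c a * x a)"
      using insert by (intro sum.cong) auto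
    then show ?thesis using insert by simp
  qed
  have "(\<Sum>x\<in>signs (insert i I). (\<Sum>a\<in>insert i I. c a * x a)\<^sup>2)
      = (\<Sum>x\<in>signs I. 2 * (c i)\<^sup>2 + 2 * (\<Sum>a\<in>I. c a * x a)\<^sup>2)"
    unfolding sum_signs_insert[OF insert(2)] eq
    by (intro sum.cong) (auto simp: power2_eq_square algebra_simps)
  also have "\<dots> = 2 ^ card (insert i I) * (\<Sum>a\<in>insert i I. (c a)\<^sup>2)"
    using insert by (simp add: sum.distrib card_signs algebra_simps flip: sum_distrib_left)
  finally show ?case .
qed

text \<open>Adding coordinate \<open>i\<close> with sign \<open>t\<close> changes the centred form
  \<open>S x\<close> into \<open>S x + 2 * t * L x\<close> with \<open>L\<close> linear, because the
  diagonal term is constant. Averaging over \<open>t\<close> removes the cross term, and the linear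
  case evaluates the rest. Only the squares of the diagonal entries are given away.\<close>

lemma sum_signs_quadratic_variance:
  fixes P :: "'a \<Rightarrow> 'a \<Rightarrow> real"
  assumes "finite I" and sym: "\<And>a b. P a b = P b a"
  shows "(\<Sum>x\<in>signs I. ((\<Sum>a\<in>I. \<Sum>b\<in>I. P a b * x a * x b) - (\<Sum>a\<in>I. P a a))\<^sup>2)
     \<le> 2 ^ card I * (2 * (\<Sum>a\<in>I. \<Sum>b\<in>I. (P a b)\<^sup>2))"
  using assms(1)
proof (induction I rule: finite_induct)
  case empty
  then show ?case by simp
next
  case (insert i I)
  define S where "S x = (\<Sum>a\<in>I. \<Sum>b\<in>I. P a b * x a * x b) - (\<Sum>a\<in>I. P a a)" for x
  define L where "L x = (\<Sum>a\<in>I. P i a * x a)" for x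
  have eq: "(\<Sum>a\<in>insert i I. \<Sum>b\<in>insert i I. P a b * (x(i := t)) a * (x(i := t)) b)
       - (\<Sum>a\<in>insert i I. P a a) = S x + 2 * t * L x" if "t * t = 1" for x :: "'a \<Rightarrow> real" and t :: real
  proof -
    define y where "y = x(i := t)"
    have y: "y i = t" "\<And>a. a \<in> I \<Longrightarrow> y a = x a" using insert by (auto simp: y_def)
    have "(\<Sum>a\<in>insert i I. \<Sum>b\<in>insert i I. P a b * y a * y b)
        = P i i * (t * t) + (\<Sum>b\<in>I. P i b * t * y b) + (\<Sum>a\<in>I. P a i * y a * t)
          + (\<Sum>a\<in>I. \<Sum>b\<in>I. P a b * y a * y b)"
      using insert y(1) by (simp add: sum.distrib)
    also have "(\<Sum>b\<in>I. P i b * t * y b) = t * L x"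
      unfolding L_def sum_distrib_left by (intro sum.cong) (auto simp: y)
    also have "(\<Sum>a\<in>I. P a i * y a * t) = t * L x"
      unfolding L_def sum_distrib_left using sym by (intro sum.cong) (auto simp: y)
    also have "(\<Sum>a\<in>I. \<Sum>b\<in>I. P a b * y a * y b) = (\<Sum>a\<in>I. \<Sum>b\<in>I. P a b * x a * x b)"
      by (intro sum.cong) (auto simp: y)
    finally show ?thesis using insert that by (simp add: S_def flip: y_def)
  qed
  have "(\<Sum>x\<in>signs (insert i I). ((\<Sum>a\<in>insert i I. \<Sum>b\<in>insert i I. P a b * x a * x b) - (\<Sum>a\<in>insert i I. P a a))\<^sup>2)
      = (\<Sum>x\<in>signs I. (S x + 2 * 1 * L x)\<^sup>2 + (S x + 2 * (-1) * L x)\<^sup>2)"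
    unfolding sum_signs_insert[OF insert(2)] by (subst (1 2) eq) auto
  also have "\<dots> = (\<Sum>x\<in>signs I. 2 * (S x)\<^sup>2 + 8 * (L x)\<^sup>2)"
    by (intro sum.cong) (auto simp: power2_eq_square algebra_simps)
  also have "\<dots> = 2 * (\<Sum>x\<in>signs I. (S x)\<^sup>2) + 8 * (2 ^ card I * (\<Sum>a\<in>I. (P i a)\<^sup>2))"
    unfolding sum.distrib sum_distrib_left[symmetric] L_def using sum_signs_linear_square[OF insert(1)] by simp
  also have "\<dots> \<le> 2 * (2 ^ card I * (2 * (\<Sum>a\<in>I. \<Sum>b\<in>I. (P a b)\<^sup>2))) + 8 * (2 ^ card I * (\<Sum>a\<in>I. (P i a)\<^sup>2))"
    using insert(3) unfolding S_def by simp
  also have "\<dots> = 2 ^ card (insert i I) * (2 * ((\<Sum>a\<in>I. \<Sum>b\<in>I. (P a b)\<^sup>2) + 2 * (\<Sum>a\<in>I. (P i a)\<^sup>2)))"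
    using insert by (simp add: algebra_simps)
  also have "\<dots> \<le> 2 ^ card (insert i I) * (2 * (\<Sum>a\<in>insert i I. \<Sum>b\<in>insert i I. (P a b)\<^sup>2))"
  proof -
    have "(\<Sum>a\<in>I. (P a i)\<^sup>2) = (\<Sum>a\<in>I. (P i a)\<^sup>2)" using sym by simp
    then have "(\<Sum>a\<in>insert i I. \<Sum>b\<in>insert i I. (P a b)\<^sup>2)
        = (P i i)\<^sup>2 + 2 * (\<Sum>a\<in>I. (P i a)\<^sup>2) + (\<Sum>a\<in>I. \<Sum>b\<in>I. (P a b)\<^sup>2)"
      using insert by (simp add: sum.distrib)
    then show ?thesis by (intro mult_left_mono) auto
  qed
  finally show ?case .
qed

text \<open>
  Gaussian elimination with full pivoting: every multiplier is at most 1 in absolute value, so each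
  elimination step at most doubles the error \<open>\<epsilon>\<close> and preserves the lower bound \<open>\<beta>\<close>, and the pivot
  coordinate of \<open>x\<close> is determined by the remaining ones.
\<close>

lemma robust_Odlyzko:
  fixes u :: "'b \<Rightarrow> 'a \<Rightarrow> real"
  assumes "finite I" "finite T" "\<epsilon> > 0" "\<epsilon> * 2 ^ card T \<le> \<beta>"
    and "\<And>j c. j \<in> T \<Longrightarrow> \<exists>i\<in>I. \<beta> \<le> \<bar>u j i + (\<Sum>l\<in>T - {j}. c l * u l i)\<bar>"
  shows "card {x \<in> signs I. \<forall>j\<in>T. \<bar>\<Sum>i\<in>I. x i * u j i\<bar> \<le> \<epsilon>} * 2 ^ card T \<le> 2 ^ card I"
  using assms
proof (induction "card T" arbitrary: T I u \<epsilon>)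
  case 0
  then show ?case using card_signs[of I] by simp
next
  case (Suc k)
  note ind = Suc.prems(5)
  have "T \<noteq> {}" using Suc.hyps by auto
  then obtain j1 where "j1 \<in> T" by auto
  then have "I \<noteq> {}" using ind by blast
  define W where "W = (\<lambda>(j, i). \<bar>u j i\<bar>) ` (T \<times> I)"
  have W: "finite W" "W \<noteq> {}" using Suc.prems \<open>T \<noteq> {}\<close> \<open>I \<noteq> {}\<close> by (auto simp: W_def)
  obtain j0 i0 where ji: "j0 \<in> T" "i0 \<in> I" "\<bar>u j0 i0\<bar> = Max W"
    using Max_in[OF W] by (auto simp: W_def)
  have mx: "\<bar>u j i\<bar> \<le> \<bar>u j0 i0\<bar>" if "j \<in> T" "i \<in> I" for j i
    using that W ji(3) by (auto simp: W_def intro!: Max_ge)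
  define p where "p = u j0 i0"
  have "(1::real) < 2 ^ card T" by (rule one_less_power) (use Suc.hyps in auto)
  then have "\<epsilon> * 1 < \<epsilon> * 2 ^ card T" using Suc.prems(3) by (rule mult_strict_left_mono)
  then have eb: "\<epsilon> < \<beta>" using Suc.prems(4) by simp
  have p: "\<beta> \<le> \<bar>p\<bar>"
  proof -
    obtain i where "i \<in> I" "\<beta> \<le> \<bar>u j0 i\<bar>" using ind[OF ji(1), of "\<lambda>_. 0"] by auto
    then show ?thesis using mx[OF ji(1)] by (force simp: p_def)
  qed
  then have p0: "p \<noteq> 0" using eb Suc.prems(3) by auto
  define v where "v j i = u j i - u j i0 / p * u j0 i" for j i
  have v0: "v j i0 = 0" for j using p0 by (simp add: v_def p_def)
  define T' I' where "T' = T - {j0}" and "I' = I - {i0}"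
  have cT: "card T = Suc (card T')" and cI: "card I = Suc (card I')"
    using ji Suc.prems card_Suc_Diff1[of T j0] card_Suc_Diff1[of I i0] by (auto simp: T'_def I'_def)
  define A where "A = {x \<in> signs I. \<forall>j\<in>T. \<bar>\<Sum>i\<in>I. x i * u j i\<bar> \<le> \<epsilon>}"
  define A' where "A' = {x \<in> signs I'. \<forall>j\<in>T'. \<bar>\<Sum>i\<in>I'. x i * v j i\<bar> \<le> 2 * \<epsilon>}"
  have IH: "card A' * 2 ^ card T' \<le> 2 ^ card I'"
    unfolding A'_def
  proof (rule Suc.hyps(1))
    show "k = card T'" "finite I'" "finite T'" "2 * \<epsilon> > 0" "2 * \<epsilon> * 2 ^ card T' \<le> \<beta>"
      using Suc.hyps Suc.prems cT by (auto simp: T'_def I'_def)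
    fix j c assume j: "j \<in> T'"
    \<comment> \<open>The coefficient of \<open>u j0\<close> is chosen so that a combination of the
      eliminated vectors \<open>v\<close> is again a combination of the \<open>u\<close>; the lower
      bound \<open>\<beta>\<close> thus passes to the smaller family.\<close>
    define c' where "c' l = (if l = j0 then - (u j i0 / p + (\<Sum>l\<in>T' - {j}. c l * (u l i0 / p))) else c l)" for l
    have eq: "u j i + (\<Sum>l\<in>T - {j}. c' l * u l i) = v j i + (\<Sum>l\<in>T' - {j}. c l * v l i)" for i
    proof -
      have "T - {j} = insert j0 (T' - {j})" using j ji by (auto simp: T'_def)
      then have "(\<Sum>l\<in>T - {j}. c' l * u l i) = c' j0 * u j0 i + (\<Sum>l\<in>T' - {j}. c' l * u l i)"
        using Suc.prems(2) by (simp add: T'_def)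
      also have "(\<Sum>l\<in>T' - {j}. c' l * u l i) = (\<Sum>l\<in>T' - {j}. c l * u l i)"
        by (intro sum.cong) (auto simp: c'_def T'_def)
      finally show ?thesis
        by (simp add: c'_def v_def right_diff_distrib sum_subtractf left_diff_distrib distrib_right sum_distrib_right mult.assoc)
    qed
    obtain i where i: "i \<in> I" "\<beta> \<le> \<bar>v j i + (\<Sum>l\<in>T' - {j}. c l * v l i)\<bar>"
      using ind[of j c'] j unfolding eq by (auto simp: T'_def)
    moreover have "i \<noteq> i0"
      using i(2) v0 eb Suc.prems(3) by (intro notI) simp
    ultimately show "\<exists>i\<in>I'. \<beta> \<le> \<bar>v j i + (\<Sum>l\<in>T' - {j}. c l * v l i)\<bar>" by (auto simp: I'_def)
  qed
  have sumI: "(\<Sum>i\<in>I. f i) = f i0 + (\<Sum>i\<in>I'. f i)" for f :: "'a \<Rightarrow> real"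
    unfolding I'_def using ji(2) Suc.prems(1) by (rule sum.remove[rotated])
  define \<phi> where "\<phi> x = restrict x I'" for x :: "'a \<Rightarrow> real"
  have "\<phi> ` A \<subseteq> A'"
  proof safe
    fix x assume x: "x \<in> A"
    have "\<phi> x \<in> signs I'"
      using x by (auto simp: \<phi>_def A_def signs_def I'_def PiE_def Pi_def extensional_def)
    moreover have "\<bar>\<Sum>i\<in>I'. \<phi> x i * v j i\<bar> \<le> 2 * \<epsilon>" if j: "j \<in> T'" for j
    proof -
      have jT: "j \<in> T" using j by (auto simp: T'_def)
      have "(\<Sum>i\<in>I'. \<phi> x i * v j i) = (\<Sum>i\<in>I. x i * v j i)"
        unfolding sumI v0 by (simp add: \<phi>_def)
      also have "\<dots> = (\<Sum>i\<in>I. x i * u j i) - u j i0 / p * (\<Sum>i\<in>I. x i * u j0 i)"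
        by (simp add: v_def right_diff_distrib sum_subtractf sum_distrib_left mult_ac)
      also have "\<bar>\<dots>\<bar> \<le> \<bar>\<Sum>i\<in>I. x i * u j i\<bar> + \<bar>u j i0 / p\<bar> * \<bar>\<Sum>i\<in>I. x i * u j0 i\<bar>"
        by (metis abs_mult abs_triangle_ineq4)
      also have "\<dots> \<le> \<epsilon> + 1 * \<epsilon>"
      proof (intro add_mono mult_mono)
        show "\<bar>u j i0 / p\<bar> \<le> 1" using mx[OF jT ji(2)] p0 by (simp add: p_def abs_divide divide_le_eq)
      qed (use x jT ji Suc.prems(3) in \<open>auto simp: A_def\<close>)
      finally show ?thesis by simp
    qed
    ultimately show "\<phi> x \<in> A'" by (simp add: A'_def)
  qed
  moreover have "inj_on \<phi> A"
  proof (rule inj_onI)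
    fix x y assume xy: "x \<in> A" "y \<in> A" "\<phi> x = \<phi> y"
    have xy': "x i = y i" if "i \<in> I'" for i using fun_cong[OF xy(3), of i] that by (simp add: \<phi>_def)
    have i0: "x i0 = y i0"
    proof (rule ccontr)
      assume "x i0 \<noteq> y i0"
      \<comment> \<open>Two signs differ by 2, so the products with \<open>u j0\<close> would differ
        by \<open>2 * \<bar>p\<bar> \<ge> 2 * \<beta> > 2 * \<epsilon>\<close>, although each is at
        most \<open>\<epsilon>\<close> in absolute value.\<close>
      then have "\<bar>x i0 - y i0\<bar> = 2"
        using signs_cases[of x I i0] signs_cases[of y I i0] xy ji by (auto simp: A_def)
      moreover have "(\<Sum>i\<in>I. x i * u j0 i) - (\<Sum>i\<in>I. y i * u j0 i) = (x i0 - y i0) * p"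
        unfolding sumI using xy' by (simp add: p_def algebra_simps)
      ultimately have "\<bar>(\<Sum>i\<in>I. x i * u j0 i) - (\<Sum>i\<in>I. y i * u j0 i)\<bar> = 2 * \<bar>p\<bar>"
        by (simp add: abs_mult)
      moreover have "\<bar>\<Sum>i\<in>I. x i * u j0 i\<bar> \<le> \<epsilon>" "\<bar>\<Sum>i\<in>I. y i * u j0 i\<bar> \<le> \<epsilon>"
        using xy ji by (auto simp: A_def)
      ultimately show False using p eb by linarith
    qed
    show "x = y"
    proof (rule PiE_ext[where k = I and s = "\<lambda>_. {-1, 1::real}"])
      show "x \<in> Pi\<^sub>E I (\<lambda>_. {-1, 1})" "y \<in> Pi\<^sub>E I (\<lambda>_. {-1, 1})" using xy by (auto simp: A_def signs_def)
      fix i assume "i \<in> I"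
      then show "x i = y i" using i0 xy' by (cases "i = i0") (auto simp: I'_def)
    qed
  qed
  moreover have "finite A'" using Suc.prems(1) by (simp add: A'_def I'_def)
  ultimately have "card A \<le> card A'" by (metis card_inj_on_le)
  then have "card A * 2 ^ card T \<le> 2 * (card A' * 2 ^ card T')"
    unfolding cT by simp
  also have "\<dots> \<le> 2 ^ card I" using IH unfolding cI by simp
  finally show ?case by (simp add: A_def)
qed

section \<open>Gram--Schmidt and the determinant\<close>

definition ip :: "nat \<Rightarrow> (nat \<Rightarrow> real) \<Rightarrow> (nat \<Rightarrow> real) \<Rightarrow> real" where
  "ip n u v = (\<Sum>i<n. u i * v i)"

definition orthonormal :: "nat \<Rightarrow> nat \<Rightarrow> (nat \<Rightarrow> nat \<Rightarrow> real) \<Rightarrow> bool" where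
  "orthonormal n d B \<longleftrightarrow> (\<forall>i<d. \<forall>j<d. ip n (B i) (B j) = of_bool (i = j))"

lemma ip_commute: "ip n u v = ip n v u"
  by (simp add: ip_def mult.commute)

lemma ip_cong: "(\<And>i. i < n \<Longrightarrow> u i = u' i) \<Longrightarrow> ip n u v = ip n u' v"
  by (simp add: ip_def)

lemma ip_add_left: "ip n (\<lambda>i. u i + u' i) v = ip n u v + ip n u' v"
  by (simp add: ip_def sum.distrib distrib_right)

lemma ip_diff_left: "ip n (\<lambda>i. u i - u' i) v = ip n u v - ip n u' v"
  by (simp add: ip_def sum_subtractf left_diff_distrib)

lemma ip_scale_left: "ip n (\<lambda>i. c * u i) v = c * ip n u v"
  by (simp add: ip_def sum_distrib_left mult.assoc)

lemma ip_scale_right: "ip n u (\<lambda>i. c * v i) = c * ip n u v"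
  by (simp add: ip_def sum_distrib_left mult_ac)

lemma ip_sum_left: "ip n (\<lambda>i. \<Sum>j\<in>T. c j * u j i) v = (\<Sum>j\<in>T. c j * ip n (u j) v)"
  unfolding ip_def sum_distrib_right sum_distrib_left
  by (subst sum.swap) (simp add: mult.assoc)

lemma ip_self_nonneg: "ip n u u \<ge> 0"
  by (simp add: ip_def sum_nonneg)

lemma ip_self_eq_0: "ip n u u = 0 \<Longrightarrow> i < n \<Longrightarrow> u i = 0"
  by (simp add: ip_def sum_nonneg_eq_0_iff)

text \<open>Pad the \<open>d\<close> vectors with zero rows to a square matrix. Row \<open>d\<close>
  vanishes, so the determinant is zero, and a normalised kernel vector is orthogonal to every
  \<open>B j\<close>.\<close>

lemma exists_unit_orthogonal:
  assumes "d < n"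
  shows "\<exists>v. ip n v v = 1 \<and> (\<forall>j<d. ip n v (B j) = 0)"
proof -
  define A where "A = Matrix.mat n n (\<lambda>(i, j). if i < d then B i j else 0 :: real)"
  have A: "A \<in> carrier_mat n n" by (simp add: A_def)
  have "det A = 0"
    unfolding det_def'[OF A]
  proof (rule sum.neutral, safe)
    fix p assume p: "p permutes {0..<n}"
    then have "p d < n" using assms permutes_in_image[OF p, of d] by simp
    then have "A $$ (d, p d) = 0" using assms by (simp add: A_def)
    then have "(\<Prod>i = 0..<n. A $$ (i, p i)) = 0" using assms by (intro prod_zero) auto
    then show "signof p * (\<Prod>i = 0..<n. A $$ (i, p i)) = 0" by simp
  qed
  then obtain w where w: "w \<in> carrier_vec n" "w \<noteq> 0\<^sub>v n" "A *\<^sub>v w = 0\<^sub>v n"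
    using det_0_iff_vec_prod_zero[OF A] by blast
  define v where "v i = w $ i" for i
  have orth: "ip n v (B j) = 0" if "j < d" for j
  proof -
    have jn: "j < n" using that assms by simp
    have "0 = (A *\<^sub>v w) $ j" using w(3) jn by simp
    also have "\<dots> = (\<Sum>i<n. B j i * w $ i)"
      using w(1) jn that by (simp add: A_def scalar_prod_def lessThan_atLeast0)
    finally show ?thesis by (simp add: ip_def v_def mult.commute)
  qed
  have "\<exists>i<n. w $ i \<noteq> 0" using w(1,2) by (metis eq_vecI carrier_vecD index_zero_vec)
  then have "ip n v v \<noteq> 0" using ip_self_eq_0[of n v] by (auto simp: v_def)
  then have pos: "ip n v v > 0" using ip_self_nonneg[of n v] by simp
  define s where "s = 1 / sqrt (ip n v v)"
  have "ip n (\<lambda>i. s * v i) (\<lambda>i. s * v i) = s * s * ip n v v"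
    by (simp add: ip_scale_left ip_scale_right)
  also have "\<dots> = 1" using pos by (simp add: s_def)
  finally show ?thesis
    using orth by (intro exI[of _ "\<lambda>i. s * v i"]) (simp add: ip_scale_left)
qed

text \<open>
  If \<open>x\<close> already lies in the span of \<open>B 0, \<dots>, B (d - 1)\<close>, then \<open>v\<close> is an arbitrary unit normal
  (with \<open>\<rho> = 0\<close>), so that the process always yields a full orthonormal basis.
\<close>

definition gs_spec :: "nat \<Rightarrow> nat \<Rightarrow> (nat \<Rightarrow> nat \<Rightarrow> real) \<Rightarrow> (nat \<Rightarrow> real) \<Rightarrow> (nat \<Rightarrow> real) \<Rightarrow> bool" where
  "gs_spec n d B x v \<longleftrightarrow> ip n v v = 1 \<and> (\<forall>j<d. ip n v (B j) = 0) \<and>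
     (\<exists>\<rho>. \<forall>i<n. x i = (\<Sum>j<d. ip n x (B j) * B j i) + \<rho> * v i)"

lemma gs_spec_exists:
  assumes B: "orthonormal n d B" and "d < n"
  shows "\<exists>v. gs_spec n d B x v"
proof -
  define r where "r i = x i - (\<Sum>j<d. ip n x (B j) * B j i)" for i
  have orth: "ip n r (B l) = 0" if "l < d" for l
  proof -
    have "ip n r (B l) = ip n x (B l) - (\<Sum>j<d. ip n x (B j) * ip n (B j) (B l))"
      unfolding r_def ip_diff_left ip_sum_left ..
    also have "(\<Sum>j<d. ip n x (B j) * ip n (B j) (B l)) = (\<Sum>j<d. if j = l then ip n x (B j) else 0)"
      using B that by (intro sum.cong) (auto simp: orthonormal_def)
    finally show ?thesis using that by simp
  qed
  show ?thesis
  proof (cases "ip n r r = 0")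
    case True
    obtain v where "ip n v v = 1" "\<forall>j<d. ip n v (B j) = 0"
      using exists_unit_orthogonal[OF assms(2)] by blast
    moreover have "\<forall>i<n. x i = (\<Sum>j<d. ip n x (B j) * B j i) + 0 * v i"
      using ip_self_eq_0[OF True] by (simp add: r_def)
    ultimately show ?thesis unfolding gs_spec_def by blast
  next
    case False
    then have pos: "ip n r r > 0" using ip_self_nonneg[of n r] by simp
    define s where "s = sqrt (ip n r r)"
    have s: "s > 0" "s * s = ip n r r" using pos by (auto simp: s_def)
    have "ip n (\<lambda>i. 1 / s * r i) (\<lambda>i. 1 / s * r i) = (1 / s) * ((1 / s) * ip n r r)"
      by (simp only: ip_scale_left ip_scale_right)
    also have "\<dots> = 1" using s by (simp flip: s(2))
    finally have 1: "ip n (\<lambda>i. 1 / s * r i) (\<lambda>i. 1 / s * r i) = 1" .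
    have 2: "\<forall>j<d. ip n (\<lambda>i. 1 / s * r i) (B j) = 0" using orth by (simp only: ip_scale_left) simp
    have "\<forall>i<n. x i = (\<Sum>j<d. ip n x (B j) * B j i) + s * (1 / s * r i)"
      using s by (simp add: r_def)
    then show ?thesis unfolding gs_spec_def using 1 2 by blast
  qed
qed

text \<open>Stage \<open>d\<close> carries a whole family of which only the indices below
  \<open>d\<close> are meaningful; the others still hold the initial zero vector.\<close>

primrec gs :: "nat \<Rightarrow> (nat \<Rightarrow> nat \<Rightarrow> real) \<Rightarrow> nat \<Rightarrow> nat \<Rightarrow> nat \<Rightarrow> real" where
  "gs n M 0 = (\<lambda>_ _. 0)"
| "gs n M (Suc d) = (gs n M d)(d := SOME v. gs_spec n d (gs n M d) (M d) v)"

text \<open>The two claims depend on each other: the choice at stage \<open>d\<close> is justified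
  only once the first \<open>d\<close> vectors are orthonormal, and its specification gives
  orthonormality at the next stage.\<close>

lemma gs_orthonormal: "d \<le> n \<Longrightarrow> orthonormal n d (gs n M d)"
  and gs_step: "d < n \<Longrightarrow> gs_spec n d (gs n M d) (M d) (gs n M (Suc d) d)"
proof -
  have step: "gs_spec n d (gs n M d) (M d) (gs n M (Suc d) d)" if "orthonormal n d (gs n M d)" "d < n" for d
    using someI_ex[OF gs_spec_exists[OF that]] by simp
  have on: "orthonormal n d (gs n M d)" if "d \<le> n" for d
    using that
  proof (induction d)
    case 0
    then show ?case by (simp add: orthonormal_def)
  next
    case (Suc d)
    then have "gs_spec n d (gs n M d) (M d) (gs n M (Suc d) d)" using step by simp
    then have v: "ip n (gs n M (Suc d) d) (gs n M (Suc d) d) = 1" "\<And>j. j < d \<Longrightarrow> ip n (gs n M (Suc d) d) (gs n M d j) = 0"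
      by (auto simp: gs_spec_def)
    have old: "gs n M (Suc d) j = gs n M d j" if "j < d" for j using that by simp
    have IH: "orthonormal n d (gs n M d)" using Suc by simp
    show ?case
      unfolding orthonormal_def
    proof (intro allI impI)
      fix i j assume "i < Suc d" "j < Suc d"
      then consider "i < d" "j < d" | "i = d" "j = d" | "i = d" "j < d" | "i < d" "j = d"
        by linarith
      then show "ip n (gs n M (Suc d) i) (gs n M (Suc d) j) = of_bool (i = j)"
      proof cases
        case 1
        then show ?thesis using IH by (simp add: old orthonormal_def del: gs.simps)
      next
        case 2
        then show ?thesis using v by (simp del: gs.simps)
      next
        case 3
        then show ?thesis using v(2)[of j] old[of j] by (simp del: gs.simps)
      next
        case 4
        then show ?thesis using v(2)[of i] old[of i] by (simp add: ip_commute del: gs.simps)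
      qed
    qed
  qed
  show "d \<le> n \<Longrightarrow> orthonormal n d (gs n M d)" by (rule on)
  show "d < n \<Longrightarrow> gs_spec n d (gs n M d) (M d) (gs n M (Suc d) d)" using step on by simp
qed

lemma gs_stable:
  assumes "j < d" "d \<le> e"
  shows "gs n M e j = gs n M d j"
  using assms(2,1) by (induction e rule: dec_induct) auto

lemma gs_cong: "(\<And>i. i < d \<Longrightarrow> M i = M' i) \<Longrightarrow> gs n M d = gs n M' d"
  by (induction d) auto

text \<open>Row \<open>i\<close> lies in the span of basis vectors \<open>0\<close> to
  \<open>i\<close>, also when the rows are dependent, and is therefore orthogonal to every later
  basis vector.\<close>

lemma gs_triangular:
  assumes "i < j" "j < n"
  shows "ip n (M i) (gs n M n j) = 0"
proof -
  let ?B = "gs n M n"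
  have B: "orthonormal n n ?B" by (rule gs_orthonormal) simp
  have "gs_spec n i (gs n M i) (M i) (gs n M (Suc i) i)" using assms by (intro gs_step) simp
  then obtain \<rho> where \<rho>: "\<And>a. a < n \<Longrightarrow> M i a = (\<Sum>l<i. ip n (M i) (gs n M i l) * gs n M i l a) + \<rho> * gs n M (Suc i) i a"
    unfolding gs_spec_def by blast
  have "M i a = (\<Sum>l<i. ip n (M i) (?B l) * ?B l a) + \<rho> * ?B i a" if "a < n" for a
  proof -
    have "(\<Sum>l<i. ip n (M i) (gs n M i l) * gs n M i l a) = (\<Sum>l<i. ip n (M i) (?B l) * ?B l a)"
      using assms by (intro sum.cong) (auto simp: gs_stable[of _ i n])
    moreover have "gs n M (Suc i) i = ?B i" using assms by (intro gs_stable[symmetric]) auto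
    ultimately show ?thesis using \<rho>[OF that] by simp
  qed
  then have "ip n (M i) (?B j) = ip n (\<lambda>a. (\<Sum>l<i. ip n (M i) (?B l) * ?B l a) + \<rho> * ?B i a) (?B j)"
    by (rule ip_cong)
  also have "\<dots> = (\<Sum>l<i. ip n (M i) (?B l) * ip n (?B l) (?B j)) + \<rho> * ip n (?B i) (?B j)"
    unfolding ip_add_left ip_sum_left ip_scale_left ..
  also have "\<dots> = 0" using B assms by (simp add: orthonormal_def)
  finally show ?thesis .
qed

section \<open>Full orthonormal bases and Parseval's identity\<close>

lemma orthonormal_mat:
  assumes "orthonormal n n B"
  defines "A \<equiv> Matrix.mat n n (\<lambda>(i, j). B i j)"
  shows "A * transpose_mat A = 1\<^sub>m n" "transpose_mat A * A = 1\<^sub>m n"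
proof -
  have A: "A \<in> carrier_mat n n" by (simp add: A_def)
  show "A * transpose_mat A = 1\<^sub>m n"
    using assms(1) by (intro eq_matI) (auto simp: A_def scalar_prod_def orthonormal_def ip_def lessThan_atLeast0)
  then show "transpose_mat A * A = 1\<^sub>m n"
    using A by (intro mat_mult_left_right_inverse[of A n]) auto
qed

lemma orthonormal_columns:
  assumes "orthonormal n n B" "a < n" "b < n"
  shows "(\<Sum>j<n. B j a * B j b) = of_bool (a = b)"
proof -
  let ?A = "Matrix.mat n n (\<lambda>(i, j). B i j)"
  have "(transpose_mat ?A * ?A) $$ (a, b) = of_bool (a = b)"
    unfolding orthonormal_mat(2)[OF assms(1)] using assms by simp
  then show ?thesis using assms by (simp add: scalar_prod_def lessThan_atLeast0)
qed

lemma Parseval: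
  assumes "orthonormal n n B"
  shows "(\<Sum>j<n. (ip n x (B j))\<^sup>2) = ip n x x"
proof -
  have "(\<Sum>j<n. (ip n x (B j))\<^sup>2) = (\<Sum>j<n. \<Sum>a<n. \<Sum>b<n. x a * x b * (B j a * B j b))"
    unfolding ip_def power2_eq_square sum_product by (simp add: mult_ac)
  also have "\<dots> = (\<Sum>a<n. \<Sum>j<n. \<Sum>b<n. x a * x b * (B j a * B j b))" by (rule sum.swap)
  also have "\<dots> = (\<Sum>a<n. \<Sum>b<n. \<Sum>j<n. x a * x b * (B j a * B j b))"
    by (rule sum.cong[OF refl], rule sum.swap)
  also have "\<dots> = (\<Sum>a<n. \<Sum>b<n. if a = b then x a * x b else 0)"
    unfolding sum_distrib_left[symmetric]
    by (intro sum.cong refl) (auto simp: orthonormal_columns[OF assms])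
  also have "\<dots> = ip n x x" by (simp add: ip_def)
  finally show ?thesis .
qed

text \<open>
  The squared distance from row \<open>d\<close> to the span of the previous rows, except when these are linearly
  dependent; it depends only on the rows up to \<open>d\<close>, although the basis vectors in the sum do not.
\<close>

definition residual :: "nat \<Rightarrow> (nat \<Rightarrow> nat \<Rightarrow> real) \<Rightarrow> nat \<Rightarrow> real" where
  "residual n M d = (\<Sum>j\<in>{d..<n}. (ip n (M d) (gs n M n j))\<^sup>2)"

text \<open>Changing row \<open>d\<close> may change every basis vector from index \<open>d\<close>
  on. By Parseval, however, the sum over these indices is the squared norm of \<open>x\<close> minus
  the sum over the earlier ones, which depend only on rows before \<open>d\<close>. The basis can
  therefore be held fixed while \<open>x\<close> varies, as conditioning on the other rows
  requires.\<close>

lemma residual_update: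
  assumes "d < n"
  shows "residual n (M(d := x)) d = (\<Sum>j\<in>{d..<n}. (ip n x (gs n M n j))\<^sup>2)"
proof -
  have split: "(\<Sum>j\<in>{d..<n}. (ip n x (gs n M' n j))\<^sup>2) = ip n x x - (\<Sum>j<d. (ip n x (gs n M' n j))\<^sup>2)" for M'
  proof -
    have "{..<n} = {..<d} \<union> {d..<n}" using assms by auto
    then have "(\<Sum>j<n. (ip n x (gs n M' n j))\<^sup>2) = (\<Sum>j<d. (ip n x (gs n M' n j))\<^sup>2) + (\<Sum>j\<in>{d..<n}. (ip n x (gs n M' n j))\<^sup>2)"
      by (simp add: sum.union_disjoint ivl_disj_int)
    then show ?thesis using Parseval[OF gs_orthonormal[OF order_refl]] by simp
  qed
  have "gs n (M(d := x)) n j = gs n M n j" if "j < d" for j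
    using gs_stable[OF that, of n] gs_cong[of d "M(d := x)" M] assms by simp
  then have "(\<Sum>j<d. (ip n x (gs n (M(d := x)) n j))\<^sup>2) = (\<Sum>j<d. (ip n x (gs n M n j))\<^sup>2)" by simp
  then show ?thesis unfolding residual_def split by (simp add: split)
qed

text \<open>Multiplying by the transpose of the orthogonal matrix \<open>Q\<close> of the
  Gram--Schmidt basis makes the matrix lower triangular and keeps the squared determinant. By the
  same triangularity, each residual reduces to its term \<open>j = d\<close>, the square of a
  diagonal entry.\<close>

lemma det_square_eq_prod_residual:
  "(det (Matrix.mat n n (\<lambda>(i, j). M i j)))\<^sup>2 = (\<Prod>d<n. residual n M d)"
proof -
  let ?B = "gs n M n"
  define A where "A = Matrix.mat n n (\<lambda>(i, j). M i j)"
  define Q where "Q = Matrix.mat n n (\<lambda>(i, j). ?B i j)"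
  have A: "A \<in> carrier_mat n n" and Q: "Q \<in> carrier_mat n n" by (simp_all add: A_def Q_def)
  have B: "orthonormal n n ?B" by (rule gs_orthonormal) simp
  have AQ: "(A * transpose_mat Q) $$ (i, j) = ip n (M i) (?B j)" if "i < n" "j < n" for i j
    using that by (simp add: A_def Q_def scalar_prod_def ip_def lessThan_atLeast0)
  have "det Q * det Q = 1"
    using det_mult[OF Q, of "transpose_mat Q"] det_transpose[OF Q] Q orthonormal_mat(1)[OF B, folded Q_def] by simp
  moreover have "det A * det Q = (\<Prod>d<n. ip n (M d) (?B d))"
  proof -
    have "det A * det Q = det (A * transpose_mat Q)"
      using det_mult[OF A, of "transpose_mat Q"] det_transpose[OF Q] Q by simp
    also have "\<dots> = prod_list (diag_mat (A * transpose_mat Q))"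
    proof (rule det_lower_triangular)
      show "(A * transpose_mat Q) $$ (i, j) = 0" if "i < j" "j < n" for i j
        using that gs_triangular[OF that] by (subst AQ) auto
    qed (use A Q in auto)
    also have "\<dots> = (\<Prod>d<n. ip n (M d) (?B d))"
    proof -
      have "dim_row (A * transpose_mat Q) = n" using A by simp
      then show ?thesis unfolding prod_list_diag_prod
        by (intro prod.cong) (auto simp: AQ simp del: index_mult_mat)
    qed
    finally show ?thesis .
  qed
  ultimately have "(det A)\<^sup>2 = (\<Prod>d<n. ip n (M d) (?B d))\<^sup>2"
    by (metis (no_types, lifting) mult.right_neutral power2_eq_square power_mult_distrib)
  also have "\<dots> = (\<Prod>d<n. (ip n (M d) (?B d))\<^sup>2)" by (simp add: prod_power_distrib)
  also have "\<dots> = (\<Prod>d<n. residual n M d)"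
  proof (intro prod.cong refl)
    fix d assume "d \<in> {..<n}"
    then have "residual n M d = (\<Sum>j\<in>{d}. (ip n (M d) (?B j))\<^sup>2)"
      unfolding residual_def by (intro sum.mono_neutral_right) (auto simp: gs_triangular)
    then show "(ip n (M d) (?B d))\<^sup>2 = residual n M d" by simp
  qed
  finally show ?thesis by (simp add: A_def)
qed

section \<open>Random sign matrices\<close>

definition sign_matrices :: "nat \<Rightarrow> (nat \<Rightarrow> nat \<Rightarrow> real) set" where
  "sign_matrices n = Pi\<^sub>E {..<n} (\<lambda>_. signs {..<n})"

lemma finite_sign_matrices [simp]: "finite (sign_matrices n)"
  by (simp add: sign_matrices_def finite_PiE)

lemma card_sign_matrices: "card (sign_matrices n) = (2 ^ n) ^ n"
  by (simp add: sign_matrices_def card_PiE card_signs)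

text \<open>A bound conditional on all rows but \<open>d\<close> averages to an unconditional one.
  Row \<open>d\<close> of \<open>M\<close> is left unconstrained in the assumption since
  \<open>x\<close> overwrites it.\<close>

lemma sum_sign_matrices_le_row:
  fixes g :: "(nat \<Rightarrow> nat \<Rightarrow> real) \<Rightarrow> real"
  assumes "d < n"
    and "\<And>M. (\<And>i j. i < n \<Longrightarrow> i \<noteq> d \<Longrightarrow> j < n \<Longrightarrow> \<bar>M i j\<bar> = 1) \<Longrightarrow> (\<Sum>x\<in>signs {..<n}. g (M(d := x))) \<le> c * 2 ^ n"
  shows "(\<Sum>M\<in>sign_matrices n. g M) \<le> c * card (sign_matrices n)"
proof -
  let ?R = "Pi\<^sub>E ({..<n} - {d}) (\<lambda>_. signs {..<n})"
  have "(\<Sum>M\<in>sign_matrices n. g M) = (\<Sum>M\<in>?R. \<Sum>x\<in>signs {..<n}. g (M(d := x)))"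
    unfolding sign_matrices_def using assms(1) by (intro sum_PiE_split) simp
  also have "\<dots> \<le> (\<Sum>M\<in>?R. c * 2 ^ n)"
  proof (intro sum_mono assms(2))
    fix M i j assume "M \<in> ?R" "i < n" "i \<noteq> d" "j < n"
    then have "M i \<in> signs {..<n}" by auto
    then show "\<bar>M i j\<bar> = 1" using signs_cases[of "M i" "{..<n}" j] \<open>j < n\<close> by auto
  qed
  also have "\<dots> = c * (2 ^ n * (2 ^ n) ^ (n - 1))"
    using assms(1) by (simp add: card_PiE card_signs)
  also have "(2::real) ^ n * (2 ^ n) ^ (n - 1) = card (sign_matrices n)"
    using assms(1) by (cases n) (simp_all add: card_sign_matrices)
  finally show ?thesis by simp
qed

text \<open>The residual is the quadratic form of the orthogonal projection \<open>P\<close> onto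
  the last \<open>n - d\<close> basis vectors. Its trace \<open>n - d\<close> is the mean; since
  \<open>P\<close> is symmetric and idempotent, the sum of its squared entries equals the trace, and
  this controls the variance.\<close>

lemma residual_variance:
  assumes "d < n"
  shows "(\<Sum>x\<in>signs {..<n}. (residual n (M(d := x)) d - real (n - d))\<^sup>2) \<le> 2 * real (n - d) * 2 ^ n"
proof -
  define B where "B = gs n M n"
  have B: "orthonormal n n B" unfolding B_def by (rule gs_orthonormal) simp
  define T where "T = {d..<n}"
  have ipB: "ip n (B j) (B l) = of_bool (j = l)" if "j \<in> T" "l \<in> T" for j l
    using B that by (simp add: orthonormal_def T_def)
  define P where "P a b = (\<Sum>j\<in>T. B j a * B j b)" for a b
  have 1: "residual n (M(d := x)) d = (\<Sum>a<n. \<Sum>b<n. P a b * x a * x b)" for x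
  proof -
    have "residual n (M(d := x)) d = (\<Sum>j\<in>T. \<Sum>a<n. \<Sum>b<n. B j a * B j b * x a * x b)"
      unfolding residual_update[OF assms] B_def[symmetric] T_def[symmetric] ip_def power2_eq_square sum_product
      by (simp add: mult_ac)
    also have "\<dots> = (\<Sum>a<n. \<Sum>j\<in>T. \<Sum>b<n. B j a * B j b * x a * x b)" by (rule sum.swap)
    also have "\<dots> = (\<Sum>a<n. \<Sum>b<n. \<Sum>j\<in>T. B j a * B j b * x a * x b)"
      by (rule sum.cong[OF refl], rule sum.swap)
    finally show ?thesis by (simp add: P_def sum_distrib_right)
  qed
  have 2: "(\<Sum>a<n. P a a) = real (n - d)"
  proof -
    have "(\<Sum>a<n. P a a) = (\<Sum>j\<in>T. ip n (B j) (B j))"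
      unfolding P_def ip_def by (rule sum.swap)
    also have "\<dots> = (\<Sum>j\<in>T. 1)" using ipB by (intro sum.cong) auto
    finally show ?thesis by (simp add: T_def)
  qed
  have 3: "(\<Sum>a<n. \<Sum>b<n. (P a b)\<^sup>2) = real (n - d)"
  proof -
    have "(\<Sum>b<n. (P a b)\<^sup>2) = (\<Sum>j\<in>T. (B j a)\<^sup>2)" if "a < n" for a
    proof -
      have "(\<Sum>b<n. (P a b)\<^sup>2) = ip n (\<lambda>b. \<Sum>j\<in>T. B j a * B j b) (\<lambda>b. \<Sum>j\<in>T. B j a * B j b)"
        by (simp add: ip_def P_def power2_eq_square)
      also have "\<dots> = (\<Sum>j\<in>T. B j a * (\<Sum>l\<in>T. B l a * ip n (B l) (B j)))"
        unfolding ip_sum_left by (subst ip_commute) (simp only: ip_sum_left)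
      also have "\<dots> = (\<Sum>j\<in>T. B j a * B j a)"
      proof (intro sum.cong refl)
        fix j assume j: "j \<in> T"
        have "(\<Sum>l\<in>T. B l a * ip n (B l) (B j)) = (\<Sum>l\<in>T. if l = j then B l a else 0)"
          using j by (intro sum.cong) (auto simp: ipB)
        then show "B j a * (\<Sum>l\<in>T. B l a * ip n (B l) (B j)) = B j a * B j a"
          using j by (simp add: T_def)
      qed
      finally show ?thesis by (simp add: power2_eq_square)
    qed
    then have "(\<Sum>a<n. \<Sum>b<n. (P a b)\<^sup>2) = (\<Sum>a<n. P a a)"
      by (intro sum.cong) (auto simp: P_def power2_eq_square)
    then show ?thesis using 2 by simp
  qed
  have "P a b = P b a" for a b by (simp add: P_def mult.commute)
  from sum_signs_quadratic_variance[of "{..<n}" P, OF _ this] show ?thesis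
    unfolding 1 2 3 by (simp add: mult_ac)
qed

text \<open>A small residual makes \<open>x\<close> nearly orthogonal to the \<open>k\<close> basis
  vectors from index \<open>d\<close> on. Robust Odlyzko applies with
  \<open>\<beta> = 1 / sqrt n\<close>: a combination of them with coefficient 1 at
  \<open>B j\<close> has norm at least 1, hence a coordinate of at least this size. The free
  parameter \<open>k\<close> allows fewer vectors to be used when \<open>\<epsilon>\<close> is too
  large for all \<open>n - d\<close>.\<close>

lemma residual_small_ball:
  assumes "d < n" "k \<le> n - d" "\<epsilon> > 0" "\<epsilon> * 2 ^ k \<le> 1 / sqrt n"
  shows "(\<Sum>x\<in>signs {..<n}. of_bool (residual n (M(d := x)) d \<le> \<epsilon>\<^sup>2)) \<le> ((1 / 2) ^ k * 2 ^ n :: real)"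
proof -
  define B where "B = gs n M n"
  have B: "orthonormal n n B" unfolding B_def by (rule gs_orthonormal) simp
  define T where "T = {d..<d + k}"
  define A where "A = {x \<in> signs {..<n}. \<forall>j\<in>T. \<bar>\<Sum>i\<in>{..<n}. x i * B j i\<bar> \<le> \<epsilon>}"
  have "card A * 2 ^ card T \<le> 2 ^ card {..<n}"
    unfolding A_def
  proof (rule robust_Odlyzko[where \<beta> = "1 / sqrt n"])
    fix j c assume j: "j \<in> T"
    have jn: "j < n" using j assms by (auto simp: T_def)
    define w where "w i = B j i + (\<Sum>l\<in>T - {j}. c l * B l i)" for i
    have "ip n w (B j) = ip n (B j) (B j) + (\<Sum>l\<in>T - {j}. c l * ip n (B l) (B j))"
      unfolding w_def ip_add_left ip_sum_left ..
    also have "(\<Sum>l\<in>T - {j}. c l * ip n (B l) (B j)) = 0"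
      using B j assms by (intro sum.neutral) (auto simp: orthonormal_def T_def)
    finally have "ip n w (B j) = 1" using B jn by (simp add: orthonormal_def)
    then have "1 = (\<Sum>l\<in>{j}. (ip n w (B l))\<^sup>2)" by simp
    also have "\<dots> \<le> (\<Sum>l<n. (ip n w (B l))\<^sup>2)" using j assms by (intro sum_mono2) (auto simp: T_def)
    also have "\<dots> = ip n w w" by (rule Parseval[OF B])
    finally have w1: "1 \<le> ip n w w" .
    show "\<exists>i\<in>{..<n}. 1 / sqrt n \<le> \<bar>B j i + (\<Sum>l\<in>T - {j}. c l * B l i)\<bar>"
    proof (rule ccontr)
      assume "\<not> ?thesis"
      then have lt: "\<bar>w i\<bar> < 1 / sqrt n" if "i < n" for i using that by (auto simp: w_def not_le)
      have "ip n w w < (\<Sum>i<n. 1 / real n)"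
        unfolding ip_def
      proof (rule sum_strict_mono)
        fix i assume "i \<in> {..<n}"
        then have "\<bar>w i\<bar> * \<bar>w i\<bar> < 1 / sqrt n * (1 / sqrt n)" using lt by (intro mult_strict_mono') auto
        then show "w i * w i < 1 / real n" by simp
      qed (use assms in auto)
      also have "\<dots> = 1" using assms by simp
      finally show False using w1 by simp
    qed
  qed (use assms in \<open>auto simp: T_def\<close>)
  then have cA: "real (card A) \<le> (1 / 2) ^ k * 2 ^ n"
    by (simp add: T_def field_simps flip: of_nat_le_iff[where 'a = real])
  have "x \<in> A" if x: "x \<in> signs {..<n}" "residual n (M(d := x)) d \<le> \<epsilon>\<^sup>2" for x
  proof -
    have "\<bar>ip n x (B j)\<bar> \<le> \<epsilon>" if "j \<in> T" for j
    proof (rule power2_le_imp_le)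
      have "\<bar>ip n x (B j)\<bar>\<^sup>2 = (\<Sum>j\<in>{j}. (ip n x (B j))\<^sup>2)" by simp
      also have "\<dots> \<le> (\<Sum>j\<in>{d..<n}. (ip n x (B j))\<^sup>2)"
        using that assms by (intro sum_mono2) (auto simp: T_def)
      also have "\<dots> \<le> \<epsilon>\<^sup>2" using x(2) unfolding residual_update[OF assms(1)] B_def .
      finally show "\<bar>ip n x (B j)\<bar>\<^sup>2 \<le> \<epsilon>\<^sup>2" .
    qed (use assms in simp)
    then show ?thesis using x(1) by (simp add: A_def ip_def)
  qed
  then have "(\<Sum>x\<in>signs {..<n}. of_bool (residual n (M(d := x)) d \<le> \<epsilon>\<^sup>2)) \<le> (\<Sum>x\<in>signs {..<n}. of_bool (x \<in> A) :: real)"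
    by (intro sum_mono) auto
  also have "\<dots> = real (card A)"
    by (simp add: of_bool_def sum.If_cases A_def Int_def) 
  finally show ?thesis using cA by simp
qed

section \<open>Sign patterns and normals with many large coordinates\<close>

definition all_patterns :: "nat \<Rightarrow> nat \<Rightarrow> nat \<Rightarrow> (nat \<Rightarrow> nat \<Rightarrow> real) \<Rightarrow> bool" where
  "all_patterns n r m M \<longleftrightarrow>
     (\<forall>S. S \<subseteq> {..<n} \<and> card S = m \<longrightarrow> (\<forall>\<sigma>\<in>signs S. \<exists>i<r. \<forall>j\<in>S. M i j = \<sigma> j))"

text \<open>Otherwise all coordinates of size at least \<open>1 / (2 * n)\<close> fit into an
  \<open>m\<close>-set \<open>S\<close>. Some row agrees on \<open>S\<close> with the signs of
  \<open>e\<close>, so orthogonality bounds the absolute sum of \<open>e\<close> over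
  \<open>S\<close> by the sum outside, at most 1/2. The squared norm is then at most 1/2 from
  \<open>S\<close> plus 1/4 from outside, contradicting norm 1.\<close>

lemma normal_spread:
  assumes pat: "all_patterns n r m M" and "m \<le> n" "n > 0"
    and e: "ip n e e = 1" "\<And>i. i < r \<Longrightarrow> ip n (M i) e = 0"
    and M: "\<And>i j. i < r \<Longrightarrow> j < n \<Longrightarrow> \<bar>M i j\<bar> = 1"
  shows "\<exists>S\<subseteq>{..<n}. card S = m \<and> (\<forall>j\<in>S. 1 / (2 * real n) \<le> \<bar>e j\<bar>)"
proof (rule ccontr)
  assume neg: "\<not> ?thesis"
  define \<tau> where "\<tau> = 1 / (2 * real n)"
  define U where "U = {j \<in> {..<n}. \<tau> \<le> \<bar>e j\<bar>}"
  have "card U < m"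
  proof (rule ccontr)
    assume "\<not> card U < m"
    then obtain S where "S \<subseteq> U" "card S = m" by (meson not_less obtain_subset_with_card_n)
    then show False using neg by (auto simp: U_def \<tau>_def)
  qed
  then obtain S where S: "U \<subseteq> S" "S \<subseteq> {..<n}" "card S = m"
    using exists_subset_between[of U m "{..<n}"] assms(2) by (auto simp: U_def)
  define \<sigma> where "\<sigma> = (\<lambda>j\<in>S. if e j \<ge> 0 then 1 else -1 :: real)"
  have "\<sigma> \<in> signs S" by (auto simp: \<sigma>_def signs_def)
  then have "\<exists>i<r. \<forall>j\<in>S. M i j = \<sigma> j"
    using pat S(2,3) unfolding all_patterns_def by simp
  then obtain i where i: "i < r" "\<And>j. j \<in> S \<Longrightarrow> M i j = \<sigma> j" by auto
  have fS: "finite S" using S finite_subset by auto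
  have small: "\<bar>e j\<bar> \<le> \<tau>" if "j \<in> {..<n} - S" for j using that S by (auto simp: U_def)
  have e1: "\<bar>e j\<bar> \<le> 1" if "j < n" for j
  proof -
    have "(e j)\<^sup>2 = (\<Sum>j\<in>{j}. e j * e j)" by (simp add: power2_eq_square)
    also have "\<dots> \<le> ip n e e" unfolding ip_def using that by (intro sum_mono2) auto
    finally show ?thesis using e(1) by (simp add: abs_square_le_1)
  qed
  have split: "(\<Sum>j<n. f j) = (\<Sum>j\<in>S. f j) + (\<Sum>j\<in>{..<n} - S. f j)" for f :: "nat \<Rightarrow> real"
    using sum.subset_diff[OF S(2), of f] by simp
  have cn: "(\<Sum>j\<in>{..<n} - S. \<tau>) \<le> 1 / 2"
  proof -
    have "(\<Sum>j\<in>{..<n} - S. \<tau>) \<le> (\<Sum>j<n. \<tau>)" by (intro sum_mono2) (auto simp: \<tau>_def)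
    also have "\<dots> = 1 / 2" using assms(3) by (simp add: \<tau>_def)
    finally show ?thesis .
  qed
  have "0 = ip n (M i) e" using e(2)[OF i(1)] by simp
  also have "\<dots> = (\<Sum>j\<in>S. M i j * e j) + (\<Sum>j\<in>{..<n} - S. M i j * e j)" unfolding ip_def by (rule split)
  also have "(\<Sum>j\<in>S. M i j * e j) = (\<Sum>j\<in>S. \<bar>e j\<bar>)"
    by (intro sum.cong) (auto simp: i(2) \<sigma>_def)
  finally have "(\<Sum>j\<in>S. \<bar>e j\<bar>) = - (\<Sum>j\<in>{..<n} - S. M i j * e j)" by simp
  also have "\<dots> \<le> (\<Sum>j\<in>{..<n} - S. \<tau>)"
    unfolding sum_negf[symmetric]
  proof (rule sum_mono)
    fix j assume j: "j \<in> {..<n} - S"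
    have "\<bar>M i j * e j\<bar> = \<bar>e j\<bar>" using M[OF i(1), of j] j by (simp add: abs_mult)
    then show "- (M i j * e j) \<le> \<tau>" using small[OF j] by linarith
  qed
  finally have a: "(\<Sum>j\<in>S. \<bar>e j\<bar>) \<le> 1 / 2" using cn by simp
  have "1 = ip n e e" using e(1) by simp
  also have "\<dots> = (\<Sum>j\<in>S. e j * e j) + (\<Sum>j\<in>{..<n} - S. e j * e j)" unfolding ip_def by (rule split)
  also have "(\<Sum>j\<in>S. e j * e j) \<le> (\<Sum>j\<in>S. \<bar>e j\<bar>)"
  proof (rule sum_mono)
    fix j assume "j \<in> S"
    then have "\<bar>e j\<bar> * \<bar>e j\<bar> \<le> \<bar>e j\<bar> * 1" using e1 S by (intro mult_left_mono) auto
    then show "e j * e j \<le> \<bar>e j\<bar>" by simp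
  qed
  also have "(\<Sum>j\<in>{..<n} - S. e j * e j) \<le> (\<Sum>j\<in>{..<n} - S. \<tau> * (1 / 2))"
  proof (rule sum_mono)
    fix j assume j: "j \<in> {..<n} - S"
    have "\<tau> \<le> 1 / 2" using assms(3) by (simp add: \<tau>_def field_simps)
    then have "\<bar>e j\<bar> * \<bar>e j\<bar> \<le> \<tau> * (1 / 2)" using small[OF j] by (intro mult_mono) auto
    then show "e j * e j \<le> \<tau> * (1 / 2)" by simp
  qed
  also have "\<dots> = (\<Sum>j\<in>{..<n} - S. \<tau>) * (1 / 2)" by (simp only: sum_distrib_right)
  finally show False using a cn by simp
qed

text \<open>The pattern event concerns only rows before \<open>r \<le> d\<close>, so it does not
  depend on \<open>x\<close>, and if it fails the sum is zero. If it holds, basis vector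
  \<open>d\<close> is a unit normal to those rows and so has \<open>m\<close> large coordinates; the
  residual is at least the squared product of \<open>x\<close> with it, and Littlewood--Offord
  applies.\<close>

lemma residual_small_ball_patterns:
  assumes "d < n" "r \<le> d" "m \<le> n"
    and M: "\<And>i j. i < n \<Longrightarrow> i \<noteq> d \<Longrightarrow> j < n \<Longrightarrow> \<bar>M i j\<bar> = 1"
  shows "(\<Sum>x\<in>signs {..<n}. of_bool (all_patterns n r m (M(d := x)) \<and> residual n (M(d := x)) d < (1 / (2 * real n))\<^sup>2))
     \<le> real (m choose (m div 2)) / 2 ^ m * 2 ^ n"
proof (cases "all_patterns n r m M")
  case False
  have "all_patterns n r m (M(d := x)) \<longleftrightarrow> all_patterns n r m M" for x
  proof -
    define M' where "M' = M(d := x)"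
    have "M' i = M i" if "i < r" for i using that assms(2) by (simp add: M'_def)
    then have "all_patterns n r m M' \<longleftrightarrow> all_patterns n r m M"
      unfolding all_patterns_def by (simp cong: conj_cong)
    then show ?thesis by (simp add: M'_def)
  qed
  then show ?thesis using False by simp
next
  case True
  define e where "e = gs n M n d"
  have "orthonormal n n (gs n M n)" by (rule gs_orthonormal) simp
  then have "ip n e e = 1" using assms(1) by (simp add: orthonormal_def e_def)
  moreover have "ip n (M i) e = 0" if "i < r" for i
    unfolding e_def using that assms by (intro gs_triangular) auto
  ultimately obtain S where S: "S \<subseteq> {..<n}" "card S = m" "\<And>j. j \<in> S \<Longrightarrow> 1 / (2 * real n) \<le> \<bar>e j\<bar>"
    using normal_spread[OF True assms(3)] assms by force
  have "(\<Sum>x\<in>signs {..<n}. of_bool (all_patterns n r m (M(d := x)) \<and> residual n (M(d := x)) d < (1 / (2 * real n))\<^sup>2))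
      \<le> (\<Sum>x\<in>signs {..<n}. of_bool (\<bar>\<Sum>i<n. x i * e i\<bar> < 1 / (2 * real n)) :: real)"
  proof (rule sum_mono)
    fix x
    have "(ip n x e)\<^sup>2 \<le> residual n (M(d := x)) d"
    proof -
      have "(ip n x e)\<^sup>2 = (\<Sum>j\<in>{d}. (ip n x (gs n M n j))\<^sup>2)" by (simp add: e_def)
      also have "\<dots> \<le> (\<Sum>j\<in>{d..<n}. (ip n x (gs n M n j))\<^sup>2)" using assms(1) by (intro sum_mono2) auto
      finally show ?thesis unfolding residual_update[OF assms(1)] .
    qed
    moreover have "\<bar>ip n x e\<bar> < 1 / (2 * real n)" if "(ip n x e)\<^sup>2 < (1 / (2 * real n))\<^sup>2"
      using that by (intro power2_less_imp_less[of "\<bar>ip n x e\<bar>"]) auto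
    ultimately show "of_bool (all_patterns n r m (M(d := x)) \<and> residual n (M(d := x)) d < (1 / (2 * real n))\<^sup>2)
        \<le> (of_bool (\<bar>\<Sum>i<n. x i * e i\<bar> < 1 / (2 * real n)) :: real)"
      unfolding ip_def by force
  qed
  also have "\<dots> \<le> real (card S choose (card S div 2)) / 2 ^ card S * 2 ^ card {..<n}"
    using S assms(1) finite_subset[OF S(1)] by (intro Littlewood_Offord_subset) auto
  finally show ?thesis using S by simp
qed

lemma card_signs_pattern:
  assumes "finite I" "S \<subseteq> I" "\<sigma> \<in> signs S"
  shows "card {x \<in> signs I. \<forall>j\<in>S. x j = \<sigma> j} = 2 ^ (card I - card S)"
proof -
  have fS: "finite S" using assms finite_subset by auto
  have "{x \<in> signs I. \<forall>j\<in>S. x j = \<sigma> j} = Pi\<^sub>E I (\<lambda>j. if j \<in> S then {\<sigma> j} else {-1, 1})"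
    (is "_ = Pi\<^sub>E I ?F")
  proof (intro equalityI subsetI)
    fix x assume "x \<in> {x \<in> signs I. \<forall>j\<in>S. x j = \<sigma> j}"
    then show "x \<in> Pi\<^sub>E I ?F" by (auto simp: signs_def PiE_iff)
  next
    fix x assume x: "x \<in> Pi\<^sub>E I ?F"
    have xS: "x j = \<sigma> j" if "j \<in> S" for j using PiE_mem[OF x, of j] that assms(2) by auto
    have "x \<in> signs I" unfolding signs_def
    proof (rule PiE_I)
      fix i assume i: "i \<in> I"
      show "x i \<in> {-1, 1}"
      proof (cases "i \<in> S")
        case True
        then show ?thesis using xS signs_cases[OF assms(3) True] by auto
      next
        case False
        then show ?thesis using PiE_mem[OF x i] by simp
      qed
    qed (use PiE_arb[OF x] in auto)
    then show "x \<in> {x \<in> signs I. \<forall>j\<in>S. x j = \<sigma> j}" using xS by simp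
  qed
  also have "card \<dots> = (\<Prod>j\<in>I. if j \<in> S then 1 else 2)"
    using assms(1) by (subst card_PiE) (auto intro!: prod.cong)
  also have "\<dots> = 2 ^ card (I - S)"
    using assms(1) by (simp add: prod.If_cases Diff_eq)
  finally show ?thesis using fS assms by (simp add: card_Diff_subset)
qed

text \<open>The rows are independent, and each of the first \<open>r\<close> misses the pattern with
  probability \<open>1 - (1 / 2) ^ m\<close>.\<close>

lemma card_missing_pattern:
  assumes "r \<le> n" "S \<subseteq> {..<n}" "card S = m" "\<sigma> \<in> signs S"
  shows "real (card {M \<in> sign_matrices n. \<not> (\<exists>i<r. \<forall>j\<in>S. M i j = \<sigma> j)})
    = (1 - (1 / 2) ^ m) ^ r * card (sign_matrices n)"
proof -
  define H where "H = {x \<in> signs {..<n}. \<not> (\<forall>j\<in>S. x j = \<sigma> j)}"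
  have "H = signs {..<n} - {x \<in> signs {..<n}. \<forall>j\<in>S. x j = \<sigma> j}" by (auto simp: H_def)
  then have "real (card H) = 2 ^ n - 2 ^ (n - m)"
    using card_signs_pattern[OF _ assms(2,4)] assms(3)
    by (simp add: card_Diff_subset card_signs of_nat_diff)
  also have "m \<le> n" using assms card_mono[of "{..<n}" S] by simp
  then have "(2::real) ^ n - 2 ^ (n - m) = (1 - (1 / 2) ^ m) * 2 ^ n"
    by (simp add: power_diff power_divide field_simps)
  finally have cH: "real (card H) = (1 - (1 / 2) ^ m) * 2 ^ n" .
  have "{M \<in> sign_matrices n. \<not> (\<exists>i<r. \<forall>j\<in>S. M i j = \<sigma> j)}
      = Pi\<^sub>E {..<n} (\<lambda>i. if i < r then H else signs {..<n})"
    (is "_ = Pi\<^sub>E {..<n} ?F")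
  proof (intro equalityI subsetI)
    fix M assume "M \<in> {M \<in> sign_matrices n. \<not> (\<exists>i<r. \<forall>j\<in>S. M i j = \<sigma> j)}"
    then show "M \<in> Pi\<^sub>E {..<n} ?F" by (auto simp: sign_matrices_def H_def PiE_iff)
  next
    fix M assume M: "M \<in> Pi\<^sub>E {..<n} ?F"
    have H: "M i \<in> H" if "i < r" for i using PiE_mem[OF M, of i] that assms(1) by simp
    have "M \<in> sign_matrices n" unfolding sign_matrices_def
    proof (rule PiE_I)
      fix i assume "i \<in> {..<n}"
      then show "M i \<in> signs {..<n}" using PiE_mem[OF M, of i] by (cases "i < r") (auto simp: H_def)
    qed (use PiE_arb[OF M] in auto)
    then show "M \<in> {M \<in> sign_matrices n. \<not> (\<exists>i<r. \<forall>j\<in>S. M i j = \<sigma> j)}"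
      using H by (auto simp: H_def)
  qed
  also have "real (card \<dots>) = (\<Prod>i<n. if i < r then (1 - (1 / 2) ^ m) * 2 ^ n else 2 ^ n)"
    by (subst card_PiE) (auto intro!: prod.cong simp: cH card_signs)
  also have "\<dots> = (\<Prod>i<n. (if i < r then 1 - (1 / 2) ^ m else 1) * 2 ^ n)"
    by (intro prod.cong) auto
  also have "\<dots> = (\<Prod>i<n. if i < r then 1 - (1 / 2) ^ m else 1) * card (sign_matrices n)"
    by (simp add: prod.distrib card_sign_matrices)
  also have "(\<Prod>i<n. if i < r then 1 - (1 / 2) ^ m else 1 :: real) = (1 - (1 / 2) ^ m) ^ r"
  proof -
    have "{..<n} \<inter> {i. i < r} = {..<r}" using assms(1) by auto
    then show ?thesis by (simp add: prod.If_cases)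
  qed
  finally show ?thesis .
qed

text \<open>Union bound over at most \<open>n ^ m\<close> column sets and the \<open>2 ^ m\<close>
  patterns on each.\<close>

lemma card_not_all_patterns:
  assumes "r \<le> n"
  shows "real (card {M \<in> sign_matrices n. \<not> all_patterns n r m M})
    \<le> real n ^ m * 2 ^ m * (1 - (1 / 2) ^ m) ^ r * card (sign_matrices n)"
proof -
  define F where "F S \<sigma> = {M \<in> sign_matrices n. \<not> (\<exists>i<r. \<forall>j\<in>S. M i j = \<sigma> j)}" for S \<sigma>
  define SS where "SS = {S. S \<subseteq> {..<n} \<and> card S = m}"
  have finSS: "finite SS" by (simp add: SS_def)
  have cSS: "card SS = n choose m" using n_subsets[of "{..<n}" m] by (simp add: SS_def)
  have fin: "finite S" if "S \<in> SS" for S using that finite_subset by (auto simp: SS_def)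
  define q where "q = (1 - (1 / 2) ^ m) ^ r * real (card (sign_matrices n))"
  have "{M \<in> sign_matrices n. \<not> all_patterns n r m M} = (\<Union>S\<in>SS. \<Union>\<sigma>\<in>signs S. F S \<sigma>)"
    by (auto simp: all_patterns_def F_def SS_def)
  then have "card {M \<in> sign_matrices n. \<not> all_patterns n r m M} \<le> (\<Sum>S\<in>SS. card (\<Union>\<sigma>\<in>signs S. F S \<sigma>))"
    using finSS by (simp add: card_UN_le)
  also have "\<dots> \<le> (\<Sum>S\<in>SS. \<Sum>\<sigma>\<in>signs S. card (F S \<sigma>))"
    using fin by (intro sum_mono card_UN_le) simp
  finally have "real (card {M \<in> sign_matrices n. \<not> all_patterns n r m M}) \<le> (\<Sum>S\<in>SS. \<Sum>\<sigma>\<in>signs S. real (card (F S \<sigma>)))"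
    by (simp flip: of_nat_sum)
  also have "\<dots> = (\<Sum>S\<in>SS. \<Sum>\<sigma>\<in>signs S. q)"
    using card_missing_pattern[OF assms] by (intro sum.cong refl) (auto simp: F_def SS_def q_def)
  also have "\<dots> = (\<Sum>S\<in>SS. 2 ^ m * q)"
    using fin by (intro sum.cong) (auto simp: card_signs SS_def)
  also have "\<dots> = real (n choose m) * (2 ^ m * q)" using cSS by simp
  also have "\<dots> \<le> real (n ^ m) * (2 ^ m * q)"
  proof (rule mult_right_mono)
    show "real (n choose m) \<le> real (n ^ m)"
      by (cases "m \<le> n") (auto simp: binomial_le_pow binomial_eq_0 simp del: of_nat_power)
    show "0 \<le> 2 ^ m * q" by (simp add: q_def power_le_one)
  qed
  finally show ?thesis by (simp add: q_def mult_ac)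
qed

section \<open>Assembling the estimates\<close>

lemma sum_half_power_le: "(\<Sum>d<r. (1 / 2 :: real) ^ (K + r - d)) \<le> (1 / 2) ^ K"
proof (induction r)
  case 0
  then show ?case by simp
next
  case (Suc r)
  have "(\<Sum>d<r. (1 / 2 :: real) ^ (K + Suc r - d)) = (\<Sum>d<r. (1 / 2) * (1 / 2) ^ (K + r - d))"
  proof (intro sum.cong refl)
    fix d assume "d \<in> {..<r}"
    then have "K + Suc r - d = Suc (K + r - d)" by auto
    then show "(1 / 2 :: real) ^ (K + Suc r - d) = (1 / 2) * (1 / 2) ^ (K + r - d)" by simp
  qed
  also have "\<dots> \<le> (1 / 2) * (1 / 2) ^ K" using Suc by (simp only: sum_distrib_left[symmetric])
  finally show ?case by simp
qed

text \<open>Union bound over three kinds of failure: a missing pattern (\<open>?E1\<close>), a small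
  residual in the last \<open>K\<close> rows although all patterns occur (\<open>?E2\<close>), and a
  tiny residual in one of the first \<open>n - K\<close> rows (\<open>?E3\<close>).\<close>

lemma card_small_residual_le:
  assumes n: "n \<ge> 2" and "m \<le> n" "K \<le> n"
  shows "real (card {M \<in> sign_matrices n. \<exists>d<n. residual n M d \<le> (1 / real n ^ 3)\<^sup>2})
    \<le> (real n ^ m * 2 ^ m * (1 - (1 / 2) ^ m) ^ (n - K) + real K * (real (m choose (m div 2)) / 2 ^ m)
        + ((1 / 2) ^ K + 2 / real n)) * card (sign_matrices n)"
proof -
  let ?N = "real (card (sign_matrices n))"
  define \<epsilon> where "\<epsilon> = 1 / real n ^ 3"
  have \<epsilon>0: "\<epsilon> > 0" using n by (simp add: \<epsilon>_def)
  define b where "b = real (m choose (m div 2)) / 2 ^ m"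
  define p where "p = real n ^ m * 2 ^ m * (1 - (1 / 2) ^ m) ^ (n - K)"
  let ?E1 = "\<lambda>M. \<not> all_patterns n (n - K) m M"
  let ?E2 = "\<lambda>d M. all_patterns n (n - K) m M \<and> residual n M d < (1 / (2 * real n))\<^sup>2"
  let ?E3 = "\<lambda>d M. residual n M d \<le> \<epsilon>\<^sup>2"
  have lt: "\<epsilon>\<^sup>2 < (1 / (2 * real n))\<^sup>2"
  proof (rule power_strict_mono)
    have "2 * real n < real n ^ 3"
    proof -
      have "2 * 1 < real n * real n" using n by (intro mult_le_less_imp_less) auto
      then have "real n * 2 < real n * (real n * real n)" using n by (intro mult_strict_left_mono) auto
      then show ?thesis by (simp add: power3_eq_cube mult_ac)
    qed
    then show "\<epsilon> < 1 / (2 * real n)" unfolding \<epsilon>_def using n by (intro divide_strict_left_mono) auto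
  qed (use \<epsilon>0 in auto)
  have E1: "(\<Sum>M\<in>sign_matrices n. of_bool (?E1 M)) \<le> p * ?N"
    using card_not_all_patterns[of "n - K" n m]
    by (simp add: of_bool_def sum.If_cases Int_def p_def)
  have E2: "(\<Sum>M\<in>sign_matrices n. of_bool (?E2 d M)) \<le> b * ?N" if "n - K \<le> d" "d < n" for d
    unfolding b_def using that assms by (intro sum_sign_matrices_le_row[of d] residual_small_ball_patterns) auto
  \<comment> \<open>Capping the number of basis vectors at \<open>L\<close>, about
    \<open>2 * log 2 n\<close>, keeps \<open>\<epsilon> * 2 ^ k\<close> below \<open>1 / n\<close>.
    A capped row costs at most \<open>2 / n^2\<close>, so all of them together cost at most
    \<open>2 / n\<close>.\<close>
  obtain L where L: "2 ^ L \<le> n\<^sup>2" "n\<^sup>2 < 2 ^ (L + 1)"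
    using ex_power_ivl1[of 2 "n\<^sup>2"] n by auto
  then have Lr: "(2::real) ^ L \<le> (real n)\<^sup>2" "(real n)\<^sup>2 < 2 * 2 ^ L"
    using of_nat_le_iff[of "2 ^ L" "n\<^sup>2", where 'a = real] of_nat_less_iff[of "n\<^sup>2" "2 ^ (L + 1)", where 'a = real]
    by simp_all
  have Linv: "(1 / 2 :: real) ^ L \<le> 2 / (real n)\<^sup>2"
    using Lr n by (simp add: power_one_over field_simps)
  have E3: "(\<Sum>M\<in>sign_matrices n. of_bool (?E3 d M)) \<le> ((1 / 2) ^ (n - d) + 2 / (real n)\<^sup>2) * ?N" if d: "d < n" for d
  proof -
    define k where "k = min (n - d) L"
    have "\<epsilon> * 2 ^ k \<le> \<epsilon> * 2 ^ L" using \<epsilon>0 by (simp add: k_def)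
    also have "\<dots> \<le> \<epsilon> * (real n)\<^sup>2" using Lr \<epsilon>0 by simp
    also have "\<dots> = 1 / real n" using n by (simp add: \<epsilon>_def power3_eq_cube power2_eq_square)
    also have "\<dots> \<le> 1 / sqrt n"
    proof (rule divide_left_mono)
      show "sqrt n \<le> real n" using n by (intro real_le_lsqrt) (auto simp: power2_eq_square)
    qed (use n in auto)
    finally have "(\<Sum>M\<in>sign_matrices n. of_bool (?E3 d M)) \<le> (1 / 2) ^ k * ?N"
      using d \<epsilon>0 by (intro sum_sign_matrices_le_row[of d] residual_small_ball) (auto simp: k_def)
    also have "(1 / 2 :: real) ^ k \<le> (1 / 2) ^ (n - d) + 2 / (real n)\<^sup>2"
      using Linv by (auto simp: k_def min_def add_increasing add_increasing2)
    finally show ?thesis by (simp add: mult_right_mono)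
  qed
  have "real (card {M \<in> sign_matrices n. \<exists>d<n. residual n M d \<le> \<epsilon>\<^sup>2})
      = (\<Sum>M\<in>sign_matrices n. of_bool (\<exists>d<n. ?E3 d M))"
    by (simp add: of_bool_def sum.If_cases Int_def)
  also have "\<dots> \<le> (\<Sum>M\<in>sign_matrices n. of_bool (?E1 M) + (\<Sum>d\<in>{n - K..<n}. of_bool (?E2 d M)) + (\<Sum>d<n - K. of_bool (?E3 d M)))"
  proof (rule sum_mono)
    fix M assume "M \<in> sign_matrices n"
    have nn: "(\<Sum>d\<in>{n - K..<n}. of_bool (?E2 d M)) \<ge> (0::real)" "(\<Sum>d<n - K. of_bool (?E3 d M)) \<ge> (0::real)"
      by (auto intro: sum_nonneg)
    show "of_bool (\<exists>d<n. ?E3 d M)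
        \<le> (of_bool (?E1 M) + (\<Sum>d\<in>{n - K..<n}. of_bool (?E2 d M)) + (\<Sum>d<n - K. of_bool (?E3 d M)) :: real)"
    proof (cases "(\<exists>d<n. ?E3 d M) \<and> \<not> ?E1 M")
      case True
      then obtain d where d: "d < n" "?E3 d M" "\<not> ?E1 M" by blast
      show ?thesis
      proof (cases "d < n - K")
        case True
        have "(1::real) = of_bool (?E3 d M)" using d by simp
        also have "\<dots> \<le> (\<Sum>d<n - K. of_bool (?E3 d M))"
          using True by (intro member_le_sum) auto
        finally show ?thesis using nn by (smt (verit) of_bool_less_eq_one zero_less_eq_of_bool)
      next
        case False
        have "(1::real) = of_bool (?E2 d M)" using d lt by auto
        also have "\<dots> \<le> (\<Sum>d\<in>{n - K..<n}. of_bool (?E2 d M))"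
          using False d by (intro member_le_sum) auto
        finally show ?thesis using nn by (smt (verit) of_bool_less_eq_one zero_less_eq_of_bool)
      qed
    next
      case False
      then have "of_bool (\<exists>d<n. ?E3 d M) \<le> (of_bool (?E1 M) :: real)" by auto
      then show ?thesis using nn by linarith
    qed
  qed
  also have "\<dots> = (\<Sum>M\<in>sign_matrices n. of_bool (?E1 M))
      + (\<Sum>d\<in>{n - K..<n}. \<Sum>M\<in>sign_matrices n. of_bool (?E2 d M))
      + (\<Sum>d<n - K. \<Sum>M\<in>sign_matrices n. of_bool (?E3 d M))"
    unfolding sum.distrib
    by (subst sum.swap[of _ "sign_matrices n" "{n - K..<n}"], subst sum.swap[of _ "sign_matrices n" "{..<n - K}"]) (rule refl)
  also have "\<dots> \<le> p * ?N + (\<Sum>d\<in>{n - K..<n}. b * ?N) + (\<Sum>d<n - K. ((1 / 2) ^ (n - d) + 2 / (real n)\<^sup>2) * ?N)"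
    using E1 E2 E3 by (intro add_mono sum_mono) auto
  also have "(\<Sum>d\<in>{n - K..<n}. b * ?N) = real K * b * ?N" using assms(3) by simp
  also have "(\<Sum>d<n - K. ((1 / 2) ^ (n - d) + 2 / (real n)\<^sup>2) * ?N) \<le> ((1 / 2) ^ K + 2 / real n) * ?N"
  proof -
    have "(\<Sum>d<n - K. (1 / 2 :: real) ^ (n - d)) \<le> (1 / 2) ^ K"
      using sum_half_power_le[of K "n - K"] assms(3) by simp
    moreover have "(\<Sum>d<n - K. 2 / (real n)\<^sup>2) \<le> (\<Sum>d<n. 2 / (real n)\<^sup>2)"
      by (intro sum_mono2) auto
    moreover have "(\<Sum>d<n. 2 / (real n)\<^sup>2) = 2 / real n" using n by (simp add: power2_eq_square)
    ultimately have "(\<Sum>d<n - K. (1 / 2) ^ (n - d) + 2 / (real n)\<^sup>2) \<le> (1 / 2) ^ K + 2 / real n"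
      unfolding sum.distrib by linarith
    then show ?thesis unfolding sum_distrib_right[symmetric] by (rule mult_right_mono) simp
  qed
  finally show ?thesis by (simp add: p_def b_def \<epsilon>_def distrib_right)
qed

text \<open>Taking \<open>m\<close>-th roots reduces the claim to the case of exponent 1.\<close>

lemma poly_times_power_tendsto_0:
  fixes c :: real
  assumes "0 < c" "c < 1" "m > 0"
  shows "(\<lambda>n. real n ^ m * c ^ n) \<longlonglongrightarrow> 0"
proof -
  define x where "x = root m c"
  have x: "0 < x" "x < 1" "x ^ m = c" using assms by (auto simp: x_def)
  have "(\<lambda>n. real n * x ^ n) \<longlonglongrightarrow> 0" using x by (intro powser_times_n_limit_0) simp
  then have "(\<lambda>n. (real n * x ^ n) ^ m) \<longlonglongrightarrow> 0 ^ m" by (intro tendsto_power)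
  moreover have "(real n * x ^ n) ^ m = real n ^ m * c ^ n" for n
    by (simp add: power_mult_distrib flip: x(3) power_mult) (simp add: mult.commute)
  ultimately show ?thesis using assms by (simp add: zero_power)
qed

lemma small_residual_fraction_tendsto_0:
  "(\<lambda>n. real (card {M \<in> sign_matrices n. \<exists>d<n. residual n M d \<le> (1 / real n ^ 3)\<^sup>2})
      / card (sign_matrices n)) \<longlonglongrightarrow> 0"
proof (rule order_tendstoI)
  fix a :: real assume "a < 0"
  then show "\<forall>\<^sub>F n in sequentially. a < real (card {M \<in> sign_matrices n. \<exists>d<n. residual n M d \<le> (1 / real n ^ 3)\<^sup>2})
      / card (sign_matrices n)"
    by (intro always_eventually allI) (rule less_le_trans, auto)
next
  fix \<delta> :: real assume \<delta>: "0 < \<delta>"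
  \<comment> \<open>The parameters are chosen in the order \<open>K\<close>, then \<open>m\<close>,
    then \<open>n\<close>, and each of the four error terms receives \<open>\<delta> / 4\<close>.
    Taking \<open>m = 2 * q\<close> even makes the central binomial bound applicable.\<close>
  obtain K where K: "(1 / 2 :: real) ^ K < \<delta> / 4"
    using real_arch_pow_inv[of "\<delta> / 4" "1 / 2"] \<delta> by auto
  have "(\<lambda>q. real K * (1 / sqrt (2 * real q + 1))) \<longlonglongrightarrow> 0" by real_asymp
  then have "\<forall>\<^sub>F q in sequentially. real K * (1 / sqrt (2 * real q + 1)) < \<delta> / 4"
    using \<delta> by (intro order_tendstoD) auto
  then obtain q where q: "q \<ge> 1" "real K * (1 / sqrt (2 * real q + 1)) < \<delta> / 4"
    using eventually_conj[OF _ eventually_ge_at_top[of 1]] eventually_sequentially by (metis (no_types, lifting) eventually_happens' trivial_limit_sequentially)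
  define m where "m = 2 * q"
  have m: "m > 0" using q by (simp add: m_def)
  have "real K * (real (m choose (m div 2)) / 2 ^ m) \<le> real K * (1 / sqrt (2 * real q + 1))"
    unfolding m_def using central_binomial_upper[of q] by (intro mult_left_mono) auto
  then have Kb: "real K * (real (m choose (m div 2)) / 2 ^ m) < \<delta> / 4" using q by linarith
  define c where "c = 1 - (1 / 2 :: real) ^ m"
  have c: "0 < c" "c < 1" using m by (auto simp: c_def power_less_one_iff)
  have "(\<lambda>n. (2 ^ m / c ^ K) * (real n ^ m * c ^ n)) \<longlonglongrightarrow> (2 ^ m / c ^ K) * 0"
    using c m by (intro tendsto_mult_left poly_times_power_tendsto_0)
  then have "\<forall>\<^sub>F n in sequentially. (2 ^ m / c ^ K) * (real n ^ m * c ^ n) < \<delta> / 4"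
    using \<delta> by (intro order_tendstoD) auto
  moreover have "(\<lambda>n. 2 / real n) \<longlonglongrightarrow> 0" by real_asymp
  then have "\<forall>\<^sub>F n in sequentially. 2 / real n < \<delta> / 4"
    using \<delta> by (intro order_tendstoD) auto
  ultimately show "\<forall>\<^sub>F n in sequentially. real (card {M \<in> sign_matrices n. \<exists>d<n. residual n M d \<le> (1 / real n ^ 3)\<^sup>2})
      / card (sign_matrices n) < \<delta>"
    using eventually_ge_at_top[of "m + K + 2"]
  proof eventually_elim
    case (elim n)
    have "c ^ (n - K) = c ^ n / c ^ K" using c elim(3) by (simp add: power_diff)
    then have "real n ^ m * 2 ^ m * (1 - (1 / 2) ^ m) ^ (n - K) = (2 ^ m / c ^ K) * (real n ^ m * c ^ n)"
      by (simp add: c_def)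
    then have "real n ^ m * 2 ^ m * (1 - (1 / 2) ^ m) ^ (n - K) + real K * (real (m choose (m div 2)) / 2 ^ m)
        + ((1 / 2) ^ K + 2 / real n) < \<delta>"
      using elim(1,2) K Kb by linarith
    moreover have "real (card {M \<in> sign_matrices n. \<exists>d<n. residual n M d \<le> (1 / real n ^ 3)\<^sup>2}) / card (sign_matrices n)
        \<le> real n ^ m * 2 ^ m * (1 - (1 / 2) ^ m) ^ (n - K) + real K * (real (m choose (m div 2)) / 2 ^ m)
        + ((1 / 2) ^ K + 2 / real n)"
      using card_small_residual_le[of n m K] elim(3)
      by (subst divide_le_eq) (auto simp: card_sign_matrices)
    ultimately show ?case by linarith
  qed
qed

section \<open>Weighted deviations and the lower bound for the determinant\<close>

text \<open>
  The constant is \<open>28 = 4 \<cdot> 7\<close>: a residual above \<open>1 / n\<^sup>6\<close> has \<open>- ln (r / k) \<le> 7 ln n\<close>.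
\<close>

definition deviation :: "nat \<Rightarrow> (nat \<Rightarrow> nat \<Rightarrow> real) \<Rightarrow> real" where
  "deviation n M = (\<Sum>d<n. (residual n M d / real (n - d) - 1)\<^sup>2 * (sqrt (real (n - d)) + 28 * ln n))"

text \<open>Telescoping: \<open>1 / sqrt (n + 1)\<close> is at most twice the increment of the
  square root, which amounts to \<open>(t - s)^2 \<ge> 0\<close> for consecutive roots.\<close>

lemma sum_inverse_sqrt_le: "(\<Sum>d<n. 1 / sqrt (real (n - d))) \<le> 2 * sqrt n"
proof -
  have "(\<Sum>d<n. 1 / sqrt (real (n - d))) = (\<Sum>d<n. 1 / sqrt (real (Suc (n - Suc d))))"
    by (intro sum.cong) (auto simp: Suc_diff_Suc)
  also have "\<dots> = (\<Sum>i<n. 1 / sqrt (real (Suc i)))"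
    by (rule sum.nat_diff_reindex)
  also have "\<dots> \<le> 2 * sqrt n"
  proof (induction n)
    case 0
    then show ?case by simp
  next
    case (Suc n)
    define s t where "s = sqrt (real n)" and "t = sqrt (real (Suc n))"
    have st: "0 \<le> s" "0 < t" "s \<le> t" "t * t = s * s + 1" by (auto simp: s_def t_def)
    have "0 \<le> (t - s)\<^sup>2" by simp
    then have "2 * s * t + 1 \<le> 2 * t * t" using st(4) by (simp add: power2_eq_square algebra_simps)
    then have "2 * s + 1 / t \<le> 2 * t" using st(2) by (simp add: field_simps)
    then show ?case using Suc by (simp add: s_def t_def)
  qed
  finally show ?thesis .
qed

lemma sum_inverse_le: "n \<ge> 1 \<Longrightarrow> (\<Sum>d<n. 1 / real (n - d)) \<le> 1 + ln n"
proof -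
  assume n: "n \<ge> 1"
  have "(\<Sum>d<n. 1 / real (n - d)) = (\<Sum>d<n. 1 / real (Suc (n - Suc d)))"
    by (intro sum.cong) (auto simp: Suc_diff_Suc)
  also have "\<dots> = (\<Sum>i<n. 1 / real (Suc i))"
    by (rule sum.nat_diff_reindex)
  also have "\<dots> \<le> 1 + ln n"
    using n
  proof (induction n rule: dec_induct)
    case base
    then show ?case by simp
  next
    case (step n)
    have "ln (real n / real (Suc n)) \<le> real n / real (Suc n) - 1"
      using step by (intro ln_le_minus_one) auto
    also have "\<dots> = - (1 / real (Suc n))" by (simp add: field_simps)
    finally have "1 / real (Suc n) \<le> ln (Suc n) - ln n" using step by (simp add: ln_div del: of_nat_Suc)
    then show ?case using step by simp
  qed
  finally show ?thesis .
qed

text \<open>With \<open>k = n - d\<close>, the relative variance is at most \<open>2 / k\<close>.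
  The weight turns this into \<open>2 / sqrt k + 56 * ln n / k\<close>, whose two parts sum to order
  \<open>sqrt n\<close> and \<open>(ln n)^2\<close>.\<close>

lemma sum_deviation_le:
  assumes "n \<ge> 1"
  shows "(\<Sum>M\<in>sign_matrices n. deviation n M)
    \<le> (4 * sqrt n + 56 * ln n * (1 + ln n)) * card (sign_matrices n)"
proof -
  let ?N = "real (card (sign_matrices n))"
  define w where "w d = sqrt (real (n - d)) + 28 * ln n" for d
  have w: "w d \<ge> 0" for d using assms by (simp add: w_def)
  have row: "(\<Sum>M\<in>sign_matrices n. (residual n M d / real (n - d) - 1)\<^sup>2) \<le> 2 / real (n - d) * ?N" if d: "d < n" for d
  proof (rule sum_sign_matrices_le_row[OF d])
    fix M
    define k where "k = real (n - d)"
    have k: "k > 0" using d by (simp add: k_def)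
    have "(\<Sum>x\<in>signs {..<n}. (residual n (M(d := x)) d / k - 1)\<^sup>2)
        = (\<Sum>x\<in>signs {..<n}. (residual n (M(d := x)) d - k)\<^sup>2) / k\<^sup>2"
      unfolding sum_divide_distrib using k by (intro sum.cong refl) (simp add: field_simps power2_eq_square)
    also have "\<dots> \<le> (2 * k * 2 ^ n) / k\<^sup>2"
      using residual_variance[OF d, of M] by (intro divide_right_mono) (auto simp: k_def)
    also have "\<dots> = 2 / k * 2 ^ n" using k by (simp add: power2_eq_square)
    finally show "(\<Sum>x\<in>signs {..<n}. (residual n (M(d := x)) d / real (n - d) - 1)\<^sup>2) \<le> 2 / real (n - d) * 2 ^ n"
      by (simp add: k_def)
  qed
  have "(\<Sum>M\<in>sign_matrices n. deviation n M)
      = (\<Sum>d<n. (\<Sum>M\<in>sign_matrices n. (residual n M d / real (n - d) - 1)\<^sup>2) * w d)"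
    unfolding deviation_def w_def sum_distrib_right by (rule sum.swap)
  also have "\<dots> \<le> (\<Sum>d<n. (2 / real (n - d) * ?N) * w d)"
    using row w by (intro sum_mono mult_right_mono) auto
  also have "\<dots> = (\<Sum>d<n. (2 * (1 / sqrt (real (n - d))) + 56 * ln n * (1 / real (n - d))) * ?N)"
  proof (intro sum.cong refl)
    fix d assume "d \<in> {..<n}"
    define s where "s = sqrt (real (n - d))"
    have s: "s > 0" "real (n - d) = s * s" using \<open>d \<in> {..<n}\<close> by (auto simp: s_def)
    show "(2 / real (n - d) * ?N) * w d = (2 * (1 / sqrt (real (n - d))) + 56 * ln n * (1 / real (n - d))) * ?N"
      unfolding w_def s_def[symmetric] s(2) using s(1) by (simp add: field_simps)
  qed
  also have "\<dots> = (2 * (\<Sum>d<n. 1 / sqrt (real (n - d))) + 56 * ln n * (\<Sum>d<n. 1 / real (n - d))) * ?N"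
    by (simp only: sum_distrib_right[symmetric] sum.distrib sum_distrib_left)
  also have "\<dots> \<le> (2 * (2 * sqrt n) + 56 * ln n * (1 + ln n)) * ?N"
    using sum_inverse_sqrt_le[of n] sum_inverse_le[of n] assms
    by (intro mult_right_mono add_mono mult_left_mono) auto
  finally show ?thesis by simp
qed

text \<open>For \<open>y \<ge> 1 / 2\<close>, \<open>- ln y \<le> 2 * \<bar>1 - y\<bar>\<close>, and
  the inequality of arithmetic and geometric means splits this into \<open>1 / sqrt k\<close> and
  \<open>(y - 1)^2 * sqrt k\<close>. For smaller \<open>y\<close>,
  \<open>(y - 1)^2 \<ge> 1 / 4\<close>, so the factor 4 lets the last term absorb the a priori bound
  \<open>L\<close>.\<close>

lemma exp_deviation_le:
  fixes y k L :: real
  assumes "y > 0" "k > 0" "L \<ge> 0" "- ln y \<le> L"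
  shows "exp (- (1 / sqrt k + (y - 1)\<^sup>2 * (sqrt k + 4 * L))) \<le> y"
proof -
  have "- ln y \<le> 1 / sqrt k + (y - 1)\<^sup>2 * (sqrt k + 4 * L)"
  proof (cases "y \<ge> 1 / 2")
    case True
    define s where "s = sqrt k"
    have s: "s > 0" using assms by (simp add: s_def)
    have "- ln y = ln (1 / y)" using assms by (simp add: ln_div)
    also have "\<dots> \<le> 1 / y - 1" using assms by (intro ln_le_minus_one) auto
    also have "\<dots> = (1 - y) * (1 / y)" using assms by (simp add: field_simps)
    also have "\<dots> \<le> \<bar>1 - y\<bar> * 2"
      using True assms by (intro mult_mono) (auto simp: field_simps)
    also have "\<dots> \<le> 1 / s + (y - 1)\<^sup>2 * s"
    proof -
      have "0 \<le> (1 - s * \<bar>1 - y\<bar>)\<^sup>2" by simp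
      also have "\<dots> = 1 - 2 * s * \<bar>1 - y\<bar> + s * s * (y - 1)\<^sup>2"
        by (simp add: power2_eq_square algebra_simps)
      finally show ?thesis using s by (simp add: field_simps)
    qed
    also have "\<dots> \<le> 1 / s + (y - 1)\<^sup>2 * (s + 4 * L)" using assms by (intro add_left_mono mult_left_mono) auto
    finally show ?thesis by (simp add: s_def)
  next
    case False
    then have "(1 / 2) * (1 / 2) \<le> (1 - y) * (1 - y)" by (intro mult_mono) auto
    then have "1 / 4 \<le> (y - 1)\<^sup>2" by (simp add: power2_eq_square algebra_simps)
    then have "1 / 4 * (4 * L) \<le> (y - 1)\<^sup>2 * (sqrt k + 4 * L)"
      using assms by (intro mult_mono) auto
    then have "L \<le> 1 / sqrt k + (y - 1)\<^sup>2 * (sqrt k + 4 * L)" using assms by (simp add: add_increasing)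
    then show ?thesis using assms by linarith
  qed
  then have "exp (- (1 / sqrt k + (y - 1)\<^sup>2 * (sqrt k + 4 * L))) \<le> exp (ln y)" by simp
  then show ?thesis using assms by simp
qed

text \<open>The lower bounds for the ratios \<open>residual n M d / (n - d)\<close> are multiplied
  over \<open>d\<close>; the denominators multiply to \<open>fact n\<close>, and the terms
  \<open>1 / sqrt (n - d)\<close> contribute at most \<open>2 * sqrt n\<close> to the
  exponent.\<close>

lemma det_square_lower:
  assumes n: "n \<ge> 2" and res: "\<And>d. d < n \<Longrightarrow> residual n M d > (1 / real n ^ 3)\<^sup>2"
  shows "fact n * exp (- (2 * sqrt n + deviation n M)) \<le> (det (Matrix.mat n n (\<lambda>(i, j). M i j)))\<^sup>2"
proof -
  define y where "y d = residual n M d / real (n - d)" for d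
  define z where "z d = 1 / sqrt (real (n - d)) + (y d - 1)\<^sup>2 * (sqrt (real (n - d)) + 4 * (7 * ln n))" for d
  have le: "exp (- z d) \<le> y d" if d: "d < n" for d
    unfolding z_def
  proof (rule exp_deviation_le)
    have "0 < (1 / real n ^ 3)\<^sup>2" using n by simp
    then have r0: "residual n M d > 0" using res[OF d] by linarith
    then show y0: "y d > 0" using d by (simp add: y_def)
    have "real n ^ 6 * residual n M d \<ge> real n ^ 6 * (1 / real n ^ 3)\<^sup>2"
      using res[OF d] by (intro mult_left_mono) auto
    also have "real n ^ 6 * (1 / real n ^ 3)\<^sup>2 = 1" using n by (simp add: power_divide flip: power_mult)
    finally have "1 \<le> real n ^ 6 * residual n M d" .
    moreover have "real (n - d) * y d = residual n M d" using d by (simp add: y_def)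
    ultimately have "1 \<le> real n ^ 6 * (real (n - d) * y d)" by simp
    also have "\<dots> \<le> real n ^ 6 * (real n * y d)"
      using y0 by (intro mult_left_mono mult_right_mono) auto
    also have "\<dots> = real n ^ 7 * y d" by (simp add: eval_nat_numeral)
    finally have "ln 1 \<le> ln (real n ^ 7 * y d)" by (intro ln_mono) auto
    also have "\<dots> = 7 * ln n + ln (y d)" using n y0 by (simp add: ln_mult ln_realpow)
    finally show "- ln (y d) \<le> 7 * ln n" by simp
  qed (use d n in auto)
  have "(\<Sum>d<n. z d) \<le> 2 * sqrt n + deviation n M"
    unfolding z_def deviation_def y_def sum.distrib using sum_inverse_sqrt_le[of n] by simp
  then have "fact n * exp (- (2 * sqrt n + deviation n M)) \<le> fact n * exp (- (\<Sum>d<n. z d))"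
    by simp
  also have "\<dots> = (\<Prod>d<n. real (n - d)) * (\<Prod>d<n. exp (- z d))"
    by (simp add: fact_prod_rev exp_sum lessThan_atLeast0 flip: sum_negf)
  also have "\<dots> = (\<Prod>d<n. real (n - d) * exp (- z d))" by (simp add: prod.distrib)
  also have "\<dots> \<le> (\<Prod>d<n. residual n M d)"
  proof (rule prod_mono, safe)
    fix d assume "d < n"
    then show "real (n - d) * exp (- z d) \<le> residual n M d"
      using le[of d] by (simp add: y_def field_simps)
  qed simp
  also have "\<dots> = (det (Matrix.mat n n (\<lambda>(i, j). M i j)))\<^sup>2" by (rule det_square_eq_prod_residual[symmetric])
  finally show ?thesis .
qed

lemma small_det_fraction_tendsto_0:
  "(\<lambda>n. real (card {M \<in> sign_matrices n. \<not> sqrt (fact n) * exp (- 29 * real n powr (1 / 2) * ln n powr (1 / 2))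
        \<le> \<bar>det (Matrix.mat n n (\<lambda>(i, j). M i j))\<bar>}) / card (sign_matrices n)) \<longlonglongrightarrow> 0"
proof -
  \<comment> \<open>Squaring doubles 29 to 58, and \<open>2 * sqrt n\<close> is reserved for the
    deterministic part of the exponent; \<open>t n\<close> is what remains for the deviation.
    Markov's inequality gives \<open>h n\<close> below, of order
    \<open>1 / sqrt (ln n)\<close>.\<close>
  define t where "t n = 58 * sqrt (real n) * sqrt (ln n) - 2 * sqrt n" for n
  define Bad where "Bad n = {M \<in> sign_matrices n. \<not> sqrt (fact n) * exp (- 29 * real n powr (1 / 2) * ln n powr (1 / 2))
        \<le> \<bar>det (Matrix.mat n n (\<lambda>(i, j). M i j))\<bar>}" for n :: nat
  define Small where "Small n = {M \<in> sign_matrices n. \<exists>d<n. residual n M d \<le> (1 / real n ^ 3)\<^sup>2}" for n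
  define Dev where "Dev n = {M \<in> sign_matrices n. deviation n M > t n}" for n
  have sub: "Bad n \<subseteq> Small n \<union> Dev n" if n: "n \<ge> 3" for n
  proof
    fix M assume M: "M \<in> Bad n"
    show "M \<in> Small n \<union> Dev n"
    proof (rule ccontr)
      assume "M \<notin> Small n \<union> Dev n"
      then have res: "\<And>d. d < n \<Longrightarrow> residual n M d > (1 / real n ^ 3)\<^sup>2" and dev: "deviation n M \<le> t n"
        using M by (auto simp: Bad_def Small_def Dev_def not_le)
      define D where "D = det (Matrix.mat n n (\<lambda>(i, j). M i j))"
      have "fact n * exp (- (58 * sqrt (real n) * sqrt (ln n))) \<le> fact n * exp (- (2 * sqrt n + deviation n M))"
        using dev by (simp add: t_def)
      also have "\<dots> \<le> D\<^sup>2" unfolding D_def using n res by (intro det_square_lower) auto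
      finally have "sqrt (fact n * exp (- (58 * sqrt (real n) * sqrt (ln n)))) \<le> \<bar>D\<bar>"
        using real_sqrt_le_mono by fastforce
      moreover have "exp (- (58 * sqrt (real n) * sqrt (ln n))) = (exp (- 29 * real n powr (1 / 2) * ln n powr (1 / 2)))\<^sup>2"
        using n by (simp add: powr_half_sqrt flip: exp_double)
      ultimately have "sqrt (fact n) * exp (- 29 * real n powr (1 / 2) * ln n powr (1 / 2)) \<le> \<bar>D\<bar>"
        by (simp add: real_sqrt_mult)
      then show False using M by (simp add: Bad_def D_def)
    qed
  qed
  have fin: "finite (Small n)" "finite (Dev n)" "finite (Bad n)" for n
    by (simp_all add: Small_def Dev_def Bad_def)
  let ?N = "\<lambda>n. real (card (sign_matrices n))"
  have N: "?N n > 0" for n by (simp add: card_sign_matrices)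
  define h where "h n = (4 * sqrt n + 56 * ln n * (1 + ln n)) / t n" for n :: nat
  have dev: "real (card (Dev n)) / ?N n \<le> h n" if n: "n \<ge> 3" and t: "t n > 0" for n
  proof -
    have nn: "deviation n M \<ge> 0" for M
      unfolding deviation_def using n by (intro sum_nonneg mult_nonneg_nonneg add_nonneg_nonneg) auto
    have "real (card (Dev n)) * t n = (\<Sum>M\<in>Dev n. t n)" by simp
    also have "\<dots> \<le> (\<Sum>M\<in>Dev n. deviation n M)" by (intro sum_mono) (auto simp: Dev_def)
    also have "\<dots> \<le> (\<Sum>M\<in>sign_matrices n. deviation n M)"
      using nn by (intro sum_mono2) (auto simp: Dev_def)
    also have "\<dots> \<le> (4 * sqrt n + 56 * ln n * (1 + ln n)) * ?N n"
      using n by (intro sum_deviation_le) auto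
    finally show ?thesis using N[of n] t by (simp add: h_def divide_simps mult_ac)
  qed
  have t_pos: "\<forall>\<^sub>F n in sequentially. t n > 0"
    unfolding t_def by real_asymp
  have "h \<longlonglongrightarrow> 0" unfolding h_def t_def by real_asymp
  moreover have "(\<lambda>n. real (card (Small n)) / ?N n) \<longlonglongrightarrow> 0"
    using small_residual_fraction_tendsto_0 by (simp add: Small_def)
  ultimately have lim: "(\<lambda>n. real (card (Small n)) / ?N n + h n) \<longlonglongrightarrow> 0"
    using tendsto_add by fastforce
  have "(\<lambda>n. real (card (Bad n)) / ?N n) \<longlonglongrightarrow> 0"
  proof (rule tendsto_sandwich[OF _ _ tendsto_const lim])
    show "\<forall>\<^sub>F n in sequentially. 0 \<le> real (card (Bad n)) / ?N n" by simp
    show "\<forall>\<^sub>F n in sequentially. real (card (Bad n)) / ?N n \<le> real (card (Small n)) / ?N n + h n"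
      using t_pos eventually_ge_at_top[of 3]
    proof eventually_elim
      case (elim n)
      have "card (Bad n) \<le> card (Small n \<union> Dev n)" using sub elim fin by (intro card_mono) auto
      also have "\<dots> \<le> card (Small n) + card (Dev n)" by (rule card_Un_le)
      finally have "real (card (Bad n)) \<le> real (card (Small n)) + real (card (Dev n))" by linarith
      then have "real (card (Bad n)) / ?N n \<le> (real (card (Small n)) + real (card (Dev n))) / ?N n"
        by (rule divide_right_mono) simp
      then show ?case using dev[OF elim(2,1)] by (simp add: add_divide_distrib)
    qed
  qed
  then show ?thesis by (simp add: Bad_def)
qed

section \<open>From counting sign matrices to arbitrary probability spaces\<close>

text \<open>By independence each sign matrix is attained with probability
  \<open>(1 / 2) ^ (n * n)\<close>, on pairwise disjoint events. Only an inequality is claimed: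
  \<open>A\<close> may also contain outcomes that do not realise a matrix of
  \<open>G\<close>.\<close>

lemma random_sign_matrix_measure_ge:
  assumes X: "random_sign_entries n P X" and "n \<ge> 1" and A: "A \<in> sets P"
    and G: "G \<subseteq> sign_matrices n"
    and GA: "\<And>M \<omega>. M \<in> G \<Longrightarrow> \<omega> \<in> space P \<Longrightarrow> (\<And>i j. i < n \<Longrightarrow> j < n \<Longrightarrow> X i j \<omega> = M i j) \<Longrightarrow> \<omega> \<in> A"
  shows "real (card G) / card (sign_matrices n) \<le> measure P A"
proof -
  interpret prob_space P using X by (simp add: random_sign_entries_def)
  let ?I = "{..<n} \<times> {..<n}"
  have ind: "indep_vars (\<lambda>_. borel) (\<lambda>(i, j). X i j) ?I" using X by (simp add: random_sign_entries_def)
  \<comment> \<open>An intersection over index pairs, as the product rule for independent variables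
    expects; \<open>n \<ge> 1\<close> makes the index set nonempty.\<close>
  define atom where "atom M = (\<Inter>p\<in>?I. (case p of (i, j) \<Rightarrow> X i j) -` {case p of (i, j) \<Rightarrow> M i j} \<inter> space P)" for M
  have I: "?I \<noteq> {}" "finite ?I" using assms(2) by (auto simp: lessThan_empty_iff)
  have rv: "X i j \<in> borel_measurable P" if "i < n" "j < n" for i j
    using ind that unfolding indep_vars_def by auto
  have atom_sets: "atom M \<in> sets P" for M
    unfolding atom_def using I
  proof (intro sets.finite_INT)
    fix p assume "p \<in> ?I"
    then show "(case p of (i, j) \<Rightarrow> X i j) -` {case p of (i, j) \<Rightarrow> M i j} \<inter> space P \<in> sets P"
      using rv by (auto intro!: measurable_sets[where A = borel])
  qed
  have pr: "prob (atom M) = (1 / 2) ^ (n * n)" if M: "M \<in> sign_matrices n" for M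
  proof -
    have "prob (atom M) = (\<Prod>p\<in>?I. prob ((case p of (i, j) \<Rightarrow> X i j) -` {case p of (i, j) \<Rightarrow> M i j} \<inter> space P))"
      unfolding atom_def using indep_varsD_finite[OF ind I, of "\<lambda>p. {case p of (i, j) \<Rightarrow> M i j}"]
      by (simp add: case_prod_beta)
    also have "\<dots> = (\<Prod>p\<in>?I. 1 / 2)"
    proof (intro prod.cong refl)
      fix p assume p: "p \<in> ?I"
      obtain i j where ij: "p = (i, j)" "i < n" "j < n" using p by auto
      have "M i \<in> signs {..<n}" using M ij unfolding sign_matrices_def by auto
      then have "M i j = 1 \<or> M i j = -1" using signs_cases[of "M i" "{..<n}" j] ij by simp
      moreover have "X i j -` {c} \<inter> space P = {\<omega> \<in> space P. X i j \<omega> = c}" for c by auto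
      ultimately show "prob ((case p of (i, j) \<Rightarrow> X i j) -` {case p of (i, j) \<Rightarrow> M i j} \<inter> space P) = 1 / 2"
        using X ij by (auto simp: random_sign_entries_def)
    qed
    finally show ?thesis by simp
  qed
  have atomD: "\<omega> \<in> space P \<and> X i j \<omega> = M i j" if "\<omega> \<in> atom M" "i < n" "j < n" for \<omega> M i j
  proof -
    have "\<omega> \<in> (case (i, j) of (i, j) \<Rightarrow> X i j) -` {case (i, j) of (i, j) \<Rightarrow> M i j} \<inter> space P"
      using that(1) unfolding atom_def by (rule INT_D) (use that in simp)
    then show ?thesis by simp
  qed
  have memI: "\<omega> \<in> space P" "\<And>i j. i < n \<Longrightarrow> j < n \<Longrightarrow> X i j \<omega> = M i j" if "\<omega> \<in> atom M" for \<omega> M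
    using atomD[OF that] assms(2) by auto
  have disj: "disjoint_family_on atom G"
    unfolding disjoint_family_on_def
  proof (intro ballI impI)
    fix M M' assume M: "M \<in> G" "M' \<in> G" "M \<noteq> M'"
    have MS: "M \<in> sign_matrices n" "M' \<in> sign_matrices n" using M G by auto
    show "atom M \<inter> atom M' = {}"
    proof (rule ccontr)
      assume "atom M \<inter> atom M' \<noteq> {}"
      then obtain \<omega> where \<omega>: "\<omega> \<in> atom M" "\<omega> \<in> atom M'" by auto
      have eq: "M i j = M' i j" if "i < n" "j < n" for i j
        using memI(2)[OF \<omega>(1) that] memI(2)[OF \<omega>(2) that] by simp
      have "M = M'"
      proof (rule PiE_ext[OF MS[unfolded sign_matrices_def]])
        fix i assume i: "i \<in> {..<n}"
        have "M i \<in> signs {..<n}" "M' i \<in> signs {..<n}" using MS i unfolding sign_matrices_def by auto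
        then show "M i = M' i" unfolding signs_def using eq i by (intro PiE_ext[of "M i" "{..<n}"]) auto
      qed
      then show False using M by simp
    qed
  qed
  have finG: "finite G" using finite_subset[OF G] by simp
  have "real (card G) / card (sign_matrices n) = (\<Sum>M\<in>G. (1 / 2) ^ (n * n))"
    by (simp add: card_sign_matrices power_mult power_one_over field_simps)
  also have "\<dots> = (\<Sum>M\<in>G. prob (atom M))" using pr G by (intro sum.cong) auto
  also have "\<dots> = prob (\<Union>M\<in>G. atom M)"
    using finG atom_sets disj by (intro finite_measure_finite_Union[symmetric]) auto
  also have "\<dots> \<le> prob A"
    using A GA memI by (intro finite_measure_mono) blast+
  finally show ?thesis .
qed

text \<open>By the Leibniz formula the determinant is a polynomial in the measurable
  entries.\<close>

lemma det_random_matrix_measurable: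
  assumes "random_sign_entries n P X"
  shows "(\<lambda>\<omega>. det (random_matrix n X \<omega>)) \<in> borel_measurable P"
proof -
  interpret prob_space P using assms by (simp add: random_sign_entries_def)
  have "indep_vars (\<lambda>_. borel) (\<lambda>(i, j). X i j) ({..<n} \<times> {..<n})"
    using assms by (simp add: random_sign_entries_def)
  then have rv: "X i j \<in> borel_measurable P" if "i < n" "j < n" for i j
    using that unfolding indep_vars_def by auto
  have "det (random_matrix n X \<omega>) = (\<Sum>p | p permutes {0..<n}. signof p * (\<Prod>i = 0..<n. X i (p i) \<omega>))" for \<omega>
  proof -
    have "random_matrix n X \<omega> \<in> carrier_mat n n" by (simp add: random_matrix_def)
    then have "det (random_matrix n X \<omega>)
        = (\<Sum>p | p permutes {0..<n}. signof p * (\<Prod>i = 0..<n. random_matrix n X \<omega> $$ (i, p i)))"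
      by (rule det_def')
    also have "\<dots> = (\<Sum>p | p permutes {0..<n}. signof p * (\<Prod>i = 0..<n. X i (p i) \<omega>))"
    proof (intro sum.cong refl)
      fix p assume "p \<in> {p. p permutes {0..<n}}"
      then have "p i < n" if "i < n" for i using that permutes_in_image[of p "{0..<n}" i] by simp
      then show "signof p * (\<Prod>i = 0..<n. random_matrix n X \<omega> $$ (i, p i)) = signof p * (\<Prod>i = 0..<n. X i (p i) \<omega>)"
        by (simp add: random_matrix_def)
    qed
    finally show ?thesis .
  qed
  moreover have "(\<lambda>\<omega>. \<Sum>p | p permutes {0..<n}. signof p * (\<Prod>i = 0..<n. X i (p i) \<omega>)) \<in> borel_measurable P"
  proof (intro borel_measurable_sum borel_measurable_times borel_measurable_const borel_measurable_prod rv)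
    fix p i assume "p \<in> {p. p permutes {0..<n}}" "i \<in> {0..<n}"
    then show "i < n" "p i < n" using permutes_in_image[of p "{0..<n}" i] by auto
  qed
  ultimately show ?thesis by simp
qed

theorem theorem1p1:
  fixes P :: "nat \<Rightarrow> 'w measure"
    and X :: "nat \<Rightarrow> nat \<Rightarrow> nat \<Rightarrow> 'w \<Rightarrow> real"
  assumes "\<And>n. n \<ge> 1 \<Longrightarrow> random_sign_entries n (P n) (X n)"
  shows "(\<lambda>n. measure (P n) {\<omega> \<in> space (P n).
            \<bar>Determinant.det (random_matrix n (X n) \<omega>)\<bar>
              \<ge> sqrt (fact n) * exp (- 29 * real n powr (1 / 2) * ln (real n) powr (1 / 2))})
         \<longlonglongrightarrow> 1"
proof -
  define th where "th n = sqrt (fact n) * exp (- 29 * real n powr (1 / 2) * ln (real n) powr (1 / 2))" for n :: nat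
  define A where "A n = {\<omega> \<in> space (P n). th n \<le> \<bar>det (random_matrix n (X n) \<omega>)\<bar>}" for n
  define Bad where "Bad n = {M \<in> sign_matrices n. \<not> th n \<le> \<bar>det (Matrix.mat n n (\<lambda>(i, j). M i j))\<bar>}" for n
  let ?N = "\<lambda>n. real (card (sign_matrices n))"
  \<comment> \<open>Nothing is assumed about \<open>P 0\<close>, so this bound and \<open>up\<close>
    hold only from \<open>n = 1\<close> on, which suffices for the limit.\<close>
  have low: "1 - real (card (Bad n)) / ?N n \<le> measure (P n) (A n)" if n: "n \<ge> 1" for n
  proof -
    have "A n \<in> sets (P n)"
      unfolding A_def using det_random_matrix_measurable[OF assms[OF n]] by measurable
    moreover have "\<omega> \<in> A n" if "M \<in> sign_matrices n - Bad n" "\<omega> \<in> space (P n)"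
      "\<And>i j. i < n \<Longrightarrow> j < n \<Longrightarrow> X n i j \<omega> = M i j" for M \<omega>
    proof -
      have "random_matrix n (X n) \<omega> = Matrix.mat n n (\<lambda>(i, j). M i j)"
        unfolding random_matrix_def using that(3) by (intro eq_matI) auto
      then show ?thesis using that(1,2) by (auto simp: A_def Bad_def)
    qed
    ultimately have "real (card (sign_matrices n - Bad n)) / ?N n \<le> measure (P n) (A n)"
      using assms[OF n] n by (intro random_sign_matrix_measure_ge) auto
    moreover have "real (card (sign_matrices n - Bad n)) = ?N n - real (card (Bad n))"
    proof -
      have "Bad n \<subseteq> sign_matrices n" by (auto simp: Bad_def)
      then show ?thesis by (simp add: card_Diff_subset finite_subset card_mono of_nat_diff)
    qed
    moreover have "?N n / ?N n = 1" by (simp add: card_sign_matrices)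
    ultimately show ?thesis by (simp only: diff_divide_distrib)
  qed
  have up: "measure (P n) (A n) \<le> 1" if "n \<ge> 1" for n
    using assms[OF that] by (auto simp: random_sign_entries_def intro: prob_space.prob_le_1)
  have "(\<lambda>n. 1 - real (card (Bad n)) / ?N n) \<longlonglongrightarrow> 1 - 0"
    unfolding Bad_def th_def by (intro tendsto_diff tendsto_const small_det_fraction_tendsto_0)
  then have lim: "(\<lambda>n. 1 - real (card (Bad n)) / ?N n) \<longlonglongrightarrow> 1" by simp
  have "(\<lambda>n. measure (P n) (A n)) \<longlonglongrightarrow> 1"
  proof (rule tendsto_sandwich[OF _ _ lim tendsto_const])
    show "\<forall>\<^sub>F n in sequentially. 1 - real (card (Bad n)) / ?N n \<le> measure (P n) (A n)"
      using eventually_ge_at_top[of 1] by eventually_elim (rule low)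
    show "\<forall>\<^sub>F n in sequentially. measure (P n) (A n) \<le> 1"
      using eventually_ge_at_top[of 1] by eventually_elim (rule up)
  qed
  then show ?thesis by (simp add: A_def th_def)
qed

end
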